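(* Let $\mathbf{k}$ be a field with $\mathrm{char}(\mathbf{k})\neq 2$ and let $n\ge 2$. Then any linear embedding of $\mathbb{A}^n_{\mathbf{k}}$ into $\mathbb{P}^n_{\mathbf{k}}$ yields an inclusion $\mathrm{TAut}(\mathbb{A}^n_{\mathbf{k}})\subset G_n(\mathbf{k})$; that is, every tame automorphism of $\mathbb{A}^n_{\mathbf{k}}$ extends, via the linear embedding, to an element of $G_n(\mathbf{k})$.
   Context: The standard involution is $\sigma_n\colon [x_0:\dots:x_n]\dashrightarrow [\frac{1}{x_0}:\dots:\frac{1}{x_n}]$, and $G_n(\mathbf{k})=\langle \sigma_n,\mathrm{Aut}(\mathbb{P}^n_{\mathbf{k}})\rangle\subset \mathrm{Bir}(\mathbb{P}^n_{\mathbf{k}})$. $\mathrm{TAut}(\mathbb{A}^n_{\mathbf{k}})\subset \mathrm{Aut}(\mathbb{A}^n_{\mathbf{k}})$ is the tame group of automorphisms, generated by $\mathrm{GL}(n,\mathbf{k})$ and all elementary automorphisms, i.e. automorphisms of the form $(x_1,\dots,x_n)\mapsto (x_1+p(x_2,\dots,x_n),x_2,\dots,x_n)$ with $p\in\mathbf{k}[x_2,\dots,x_n]$. A linear embedding $\tau\colon\mathbb{A}^n_{\mathbf{k}}\to\mathbb{P}^n_{\mathbf{k}}$ is an open embedding such that the pull-back of a general hyperplane is a hyperplane (for example $(x_1,\dots,x_n)\mapsto[1:x_1:\dots:x_n]$). It yields an injective group homomorphism $\mathrm{Aut}(\mathbb{A}^n_{\mathbf{k}})\to \mathrm{Bir}(\mathbb{P}^n_{\mathbf{k}})$,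 $f\mapsto \tau f\tau^{-1}$. *)

theory Defs
  imports
    "HOL-Library.Poly_Mapping"
    "HOL-Library.FuncSet"
    "HOL-Computational_Algebra.Fraction_Field"
    "HOL-Algebra.Generated_Groups"
    "HOL-Algebra.Ideal"
    "HOL-Algebra.Algebraic_Closure_Type"
    "Jordan_Normal_Form.Matrix"
begin

section \<open>Polynomials in countably many variables\<close>

text \<open>
  The dimension is a variable, so all polynomials live in one polynomial ring with variables
  \<open>x\<^sub>0, x\<^sub>1, \<dots>\<close>, and the polynomial ring of a given space is cut out by its set of variables.
  Affine space of dimension \<open>n\<close> has the coordinates \<open>x\<^sub>1, \<dots>, x\<^sub>n\<close>, and projective space of
  dimension \<open>n\<close> the homogeneous coordinates \<open>x\<^sub>0, \<dots>, x\<^sub>n\<close>.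
\<close>

type_synonym 'k mpoly = "(nat \<Rightarrow>\<^sub>0 nat) \<Rightarrow>\<^sub>0 'k"

definition mconst :: "'k \<Rightarrow> 'k::comm_ring_1 mpoly" where
  "mconst c = Poly_Mapping.single 0 c"

definition mvar :: "nat \<Rightarrow> 'k::comm_ring_1 mpoly" where
  "mvar i = Poly_Mapping.single (Poly_Mapping.single i 1) 1"

definition polys_in :: "nat set \<Rightarrow> 'k::comm_ring_1 mpoly set" where
  "polys_in V = {p. \<forall>m\<in>Poly_Mapping.keys p. Poly_Mapping.keys m \<subseteq> V}"

definition monom_degree :: "(nat \<Rightarrow>\<^sub>0 nat) \<Rightarrow> nat" where
  "monom_degree m = (\<Sum>i\<in>Poly_Mapping.keys m. Poly_Mapping.lookup m i)"

definition homogeneous :: "nat \<Rightarrow> 'k::comm_ring_1 mpoly \<Rightarrow> bool" where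
  "homogeneous d p \<longleftrightarrow> (\<forall>m\<in>Poly_Mapping.keys p. monom_degree m = d)"

definition total_degree :: "'k::comm_ring_1 mpoly \<Rightarrow> nat" where
  "total_degree p = Max (insert 0 (monom_degree ` Poly_Mapping.keys p))"

definition insertion :: "('k \<Rightarrow> 'r) \<Rightarrow> (nat \<Rightarrow> 'r) \<Rightarrow> 'k::comm_ring_1 mpoly \<Rightarrow> 'r::comm_ring_1" where
  "insertion \<phi> a p =
     (\<Sum>m\<in>Poly_Mapping.keys p. \<phi> (Poly_Mapping.lookup p m) *
        (\<Prod>i\<in>Poly_Mapping.keys m. a i ^ Poly_Mapping.lookup m i))"

definition subst :: "(nat \<Rightarrow> 'k mpoly) \<Rightarrow> 'k::comm_ring_1 mpoly \<Rightarrow> 'k mpoly" where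
  "subst = insertion mconst"

definition poly_ring :: "nat set \<Rightarrow> 'k::comm_ring_1 mpoly ring" where
  "poly_ring V = \<lparr>carrier = polys_in V, monoid.mult = (*), one = 1, ring.zero = 0, add = (+)\<rparr>"

definition to_frac :: "'k mpoly \<Rightarrow> 'k::field mpoly fract" where
  "to_frac p = Fract p 1"


section \<open>Rational self-maps of projective space\<close>

definition proportional :: "nat \<Rightarrow> (nat \<Rightarrow> 'r::idom) \<Rightarrow> (nat \<Rightarrow> 'r) \<Rightarrow> bool" where
  "proportional n a b \<longleftrightarrow>
     (\<exists>i\<le>n. a i \<noteq> 0) \<and> (\<exists>i\<le>n. b i \<noteq> 0) \<and> (\<forall>i\<le>n. \<forall>j\<le>n. a i * b j = a j * b i)"

definition forms :: "nat \<Rightarrow> (nat \<Rightarrow> 'k::field mpoly) set" where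
  "forms n = {f. (\<forall>i\<le>n. f i \<in> polys_in {0..n}) \<and> (\<exists>d. \<forall>i\<le>n. homogeneous d (f i)) \<and>
                 (\<exists>i\<le>n. f i \<noteq> 0)}"

text \<open>
  A rational self-map is the set of all tuples of forms of equal degree that represent it.
  The following is the rational map with the given homogeneous coordinates in the fraction
  field; it is the empty set, which is not a rational map, if all these coordinates vanish.
  The entries of a tuple at indices above \<open>n\<close> play no role, and no condition is put on them.
\<close>

definition rat_map :: "nat \<Rightarrow> (nat \<Rightarrow> 'k::field mpoly fract) \<Rightarrow> (nat \<Rightarrow> 'k mpoly) set" where
  "rat_map n \<phi> = {f \<in> forms n. proportional n (\<lambda>i. to_frac (f i)) \<phi>}"

definition rat_maps :: "nat \<Rightarrow> (nat \<Rightarrow> 'k::field mpoly) set set" where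
  "rat_maps n = {rat_map n (\<lambda>i. to_frac (f i)) | f. f \<in> forms n}"

text \<open>Pairs of representatives whose formal composition vanishes contribute the empty set.\<close>

definition rat_comp ::
  "nat \<Rightarrow> (nat \<Rightarrow> 'k::field mpoly) set \<Rightarrow> (nat \<Rightarrow> 'k mpoly) set \<Rightarrow> (nat \<Rightarrow> 'k mpoly) set" where
  "rat_comp n F G = (\<Union>f\<in>F. \<Union>g\<in>G. rat_map n (\<lambda>i. to_frac (subst g (f i))))"

definition rat_id :: "nat \<Rightarrow> (nat \<Rightarrow> 'k::field mpoly) set" where
  "rat_id n = rat_map n (\<lambda>i. to_frac (mvar i))"

definition Bir :: "nat \<Rightarrow> (nat \<Rightarrow> 'k::field mpoly) set monoid" where
  "Bir n = \<lparr>carrier = {F \<in> rat_maps n. \<exists>G\<in>rat_maps n.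
                         rat_comp n F G = rat_id n \<and> rat_comp n G F = rat_id n},
            monoid.mult = rat_comp n, one = rat_id n\<rparr>"


section \<open>The group generated by automorphisms and the standard involution\<close>

definition std_involution :: "nat \<Rightarrow> (nat \<Rightarrow> 'k::field mpoly) set" where
  "std_involution n = rat_map n (\<lambda>i. 1 / to_frac (mvar i))"

text \<open>The points of the scheme \<open>Proj k[x\<^sub>0, \<dots>, x\<^sub>n]\<close>.\<close>

definition proj_points :: "nat \<Rightarrow> 'k::field mpoly set set" where
  "proj_points n = {P. primeideal P (poly_ring {0..n}) \<and>
                       P = genideal (poly_ring {0..n}) {p \<in> P. \<exists>d. homogeneous d p} \<and>
                       (\<exists>i\<le>n. mvar i \<notin> P)}"

definition everywhere_defined :: "nat \<Rightarrow> (nat \<Rightarrow> 'k::field mpoly) set \<Rightarrow> bool" where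
  "everywhere_defined n F \<longleftrightarrow> (\<forall>P\<in>proj_points n. \<exists>f\<in>F. \<exists>i\<le>n. f i \<notin> P)"

definition Aut_P :: "nat \<Rightarrow> (nat \<Rightarrow> 'k::field mpoly) set set" where
  "Aut_P n = {F \<in> carrier (Bir n). everywhere_defined n F \<and> everywhere_defined n (inv\<^bsub>Bir n\<^esub> F)}"

definition G_group :: "nat \<Rightarrow> (nat \<Rightarrow> 'k::field mpoly) set set" where
  "G_group n = generate (Bir n) (insert (std_involution n) (Aut_P n))"


section \<open>Tame automorphisms of affine space\<close>

definition aff_endos :: "nat \<Rightarrow> (nat \<Rightarrow> 'k::field mpoly) set" where
  "aff_endos n = {1..n} \<rightarrow>\<^sub>E polys_in {1..n}"

definition aff_comp ::
  "nat \<Rightarrow> (nat \<Rightarrow> 'k::field mpoly) \<Rightarrow> (nat \<Rightarrow> 'k mpoly) \<Rightarrow> (nat \<Rightarrow> 'k mpoly)" where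
  "aff_comp n f g = (\<lambda>i\<in>{1..n}. subst g (f i))"

definition aff_id :: "nat \<Rightarrow> (nat \<Rightarrow> 'k::field mpoly)" where
  "aff_id n = (\<lambda>i\<in>{1..n}. mvar i)"

definition Aut_A :: "nat \<Rightarrow> (nat \<Rightarrow> 'k::field mpoly) monoid" where
  "Aut_A n = \<lparr>carrier = {f \<in> aff_endos n. \<exists>g\<in>aff_endos n.
                           aff_comp n f g = aff_id n \<and> aff_comp n g f = aff_id n},
              monoid.mult = aff_comp n, one = aff_id n\<rparr>"

text \<open>Matrices are indexed from \<open>0\<close>, the coordinates of affine space from \<open>1\<close>.\<close>

definition GL_auts :: "nat \<Rightarrow> (nat \<Rightarrow> 'k::field mpoly) set" where
  "GL_auts n = {(\<lambda>i\<in>{1..n}. \<Sum>j\<in>{1..n}. mconst (A $$ (i - 1, j - 1)) * mvar j) | A.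
                  A \<in> carrier_mat n n \<and> invertible_mat A}"

definition elementary_auts :: "nat \<Rightarrow> (nat \<Rightarrow> 'k::field mpoly) set" where
  "elementary_auts n = {(\<lambda>i\<in>{1..n}. if i = 1 then mvar 1 + p else mvar i) | p. p \<in> polys_in {2..n}}"

definition TAut :: "nat \<Rightarrow> (nat \<Rightarrow> 'k::field mpoly) set" where
  "TAut n = generate (Aut_A n) (GL_auts n \<union> elementary_auts n)"


section \<open>Linear embeddings of affine space into projective space\<close>

text \<open>
  Line bundles on affine space are trivial and the units of its coordinate ring are the nonzero
  constants. So a morphism to projective space is a tuple of polynomials that generate the unit
  ideal, up to a nonzero constant.
\<close>

definition morphism_A_P :: "nat \<Rightarrow> (nat \<Rightarrow> 'k::field mpoly) \<Rightarrow> bool" where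
  "morphism_A_P n t \<longleftrightarrow> (\<forall>i\<le>n. t i \<in> polys_in {1..n}) \<and>
     (\<exists>u. (\<forall>i\<le>n. u i \<in> polys_in {1..n}) \<and> (\<Sum>i\<le>n. u i * t i) = 1)"

text \<open>
  A tuple of forms \<open>h\<close> with \<open>h\<^sub>0 \<noteq> 0\<close> also represents the rational map
  \<open>(h\<^sub>1/h\<^sub>0, \<dots>, h\<^sub>n/h\<^sub>0)\<close> from projective to affine space. The next function pulls back a
  polynomial function on affine space along this map.
\<close>

definition pullback :: "(nat \<Rightarrow> 'k mpoly) \<Rightarrow> 'k::field mpoly \<Rightarrow> 'k mpoly fract" where
  "pullback h p = insertion (\<lambda>c. to_frac (mconst c)) (\<lambda>i. to_frac (h i) / to_frac (h 0)) p"

text \<open>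
  The representatives \<open>h\<close> of a rational map from projective to affine space that is inverse to
  \<open>t\<close>: the last two lines say that \<open>h \<circ> t\<close> and \<open>t \<circ> h\<close> are the identity.
\<close>

definition rat_inverse :: "nat \<Rightarrow> (nat \<Rightarrow> 'k::field mpoly) \<Rightarrow> (nat \<Rightarrow> 'k mpoly) set" where
  "rat_inverse n t = {h \<in> forms n. h 0 \<noteq> 0 \<and>
     subst t (h 0) \<noteq> 0 \<and> (\<forall>i\<in>{1..n}. subst t (h i) = mvar i * subst t (h 0)) \<and>
     proportional n (\<lambda>i. pullback h (t i)) (\<lambda>i. to_frac (mvar i))}"

text \<open>
  An open embedding is a morphism with a rational inverse that is defined, as a map to affine
  space, at the image of every point of affine space. Such a morphism is an isomorphism onto the
  domain of definition of its inverse. Being defined at the image of the prime \<open>P\<close> means having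
  a representative whose denominator \<open>h\<^sub>0\<close> does not vanish there.
\<close>

definition open_embedding :: "nat \<Rightarrow> (nat \<Rightarrow> 'k::field mpoly) \<Rightarrow> bool" where
  "open_embedding n t \<longleftrightarrow> morphism_A_P n t \<and> rat_inverse n t \<noteq> {} \<and>
     (\<forall>P. primeideal P (poly_ring {1..n}) \<longrightarrow> (\<exists>h\<in>rat_inverse n t. subst t (h 0) \<notin> P))"

text \<open>
  Hyperplanes are taken over the algebraic closure, because over a finite field a nonempty open
  subset of the dual projective space need not contain any rational point. The form \<open>q\<close>
  describes such an open subset.
\<close>

definition pulls_back_general_hyperplane :: "nat \<Rightarrow> (nat \<Rightarrow> 'k::field mpoly) \<Rightarrow> bool" where
  "pulls_back_general_hyperplane n t \<longleftrightarrow>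
     (\<exists>(q :: 'k alg_closure mpoly) d. q \<in> polys_in {0..n} \<and> q \<noteq> 0 \<and> homogeneous d q \<and>
        (\<forall>a. (\<exists>i\<le>n. a i \<noteq> 0) \<and> insertion id a q \<noteq> 0 \<longrightarrow>
             total_degree (\<Sum>i\<le>n. mconst (a i) * insertion (\<lambda>c. mconst (to_ac c)) mvar (t i)) = 1))"

definition linear_embedding :: "nat \<Rightarrow> (nat \<Rightarrow> 'k::field mpoly) \<Rightarrow> bool" where
  "linear_embedding n t \<longleftrightarrow> open_embedding n t \<and> pulls_back_general_hyperplane n t"

text \<open>The birational map \<open>t \<circ> f \<circ> t\<inverse>\<close>.\<close>

definition conj_embedding ::
  "nat \<Rightarrow> (nat \<Rightarrow> 'k::field mpoly) \<Rightarrow> (nat \<Rightarrow> 'k mpoly) \<Rightarrow> (nat \<Rightarrow> 'k mpoly) set" where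
  "conj_embedding n t f = (\<Union>h\<in>rat_inverse n t. rat_map n (\<lambda>i. pullback h (subst f (t i))))"

end

theory Submission
  imports Defs "Jordan_Normal_Form.Determinant"
begin

text \<open>
  Rational maps are followed through their values at points with coordinates in the fraction field,
  so that composing with \<open>\<sigma>\<close> or a linear map from the left only means inverting all coordinates or
  evaluating linear forms. In affine coordinates, \<open>\<sigma>\<close> conjugates \<open>x\<^sub>1 \<mapsto> x\<^sub>1 + 1\<close> into
  \<open>x\<^sub>1 \<mapsto> x\<^sub>1 / (x\<^sub>1 + 1)\<close>, hence \<open>G\<^sub>n\<close> contains \<open>PGL\<^sub>2\<close> acting on a single coordinate and in
  particular \<open>x\<^sub>i \<mapsto> 1 / x\<^sub>i\<close>. Together with the exchange of \<open>x\<^sub>0\<close> and \<open>x\<^sub>r\<close>, this gives the map \<open>S\<close>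
  that divides all coordinates except \<open>x\<^sub>r\<close> by \<open>x\<^sub>r\<close>, and the map \<open>J\<close> that inverts all
  coordinates except \<open>x\<^sub>1\<close> and \<open>x\<^sub>r\<close>; then \<open>J S J S\<close> is \<open>x\<^sub>1 \<mapsto> x\<^sub>1 / x\<^sub>r\<^sup>2\<close>. Conjugating by its
  translates, the set of \<open>p\<close> such that \<open>x\<^sub>1 \<mapsto> x\<^sub>1 + p\<close> lies in \<open>G\<^sub>n\<close> is stable under multiplication
  by \<open>(x\<^sub>r + a)\<^sup>2\<close>, hence by \<open>2 x\<^sub>r = (x\<^sub>r + 1)\<^sup>2 - x\<^sub>r\<^sup>2 - 1\<close>. As \<open>2\<close> is invertible, it contains
  all polynomials in \<open>x\<^sub>2, \<dots>, x\<^sub>n\<close>.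

  The components of a linear embedding have degree at most \<open>1\<close>, since their general linear
  combinations do, and they are linearly independent because the embedding is birational. So
  a linear embedding is the standard one followed by a linear automorphism.
\<close>

section \<open>Evaluation of polynomials\<close>

text \<open>Coefficient embeddings such as \<open>mconst\<close>, \<open>to_frac\<close> and
  \<open>to_ac\<close>, as well as the evaluations themselves, are instances of this one predicate,
  so a single set of rewrite rules serves them all.\<close>

definition ring_map :: "('a::comm_ring_1 \<Rightarrow> 'b::comm_ring_1) \<Rightarrow> bool" where
  "ring_map f \<longleftrightarrow> f 1 = 1 \<and> (\<forall>x y. f (x + y) = f x + f y) \<and> (\<forall>x y. f (x * y) = f x * f y)"

lemma ring_mapD:
  assumes "ring_map f"
  shows ring_map_1: "f 1 = 1"
    and ring_map_add: "f (x + y) = f x + f y"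
    and ring_map_mult: "f (x * y) = f x * f y"
    and ring_map_0: "f 0 = 0"
  using assms unfolding ring_map_def by (simp_all, metis add_cancel_right_right)

lemma ring_map_uminus: "ring_map f \<Longrightarrow> f (- x) = - f x"
  by (metis ring_map_0 ring_map_add add.right_inverse minus_unique)

lemma ring_map_diff: "ring_map f \<Longrightarrow> f (x - y) = f x - f y"
  using ring_map_add[of f x "- y"] ring_map_uminus[of f y] by simp

lemma ring_map_sum: "ring_map f \<Longrightarrow> f (\<Sum>i\<in>A. g i) = (\<Sum>i\<in>A. f (g i))"
  by (induction A rule: infinite_finite_induct) (auto simp: ring_mapD)

lemma ring_map_prod: "ring_map f \<Longrightarrow> f (\<Prod>i\<in>A. g i) = (\<Prod>i\<in>A. f (g i))"
  by (induction A rule: infinite_finite_induct) (auto simp: ring_mapD)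

lemma ring_map_power: "ring_map f \<Longrightarrow> f (x ^ n) = f x ^ n"
  by (induction n) (auto simp: ring_mapD)

lemmas ring_map_simps = ring_mapD ring_map_uminus ring_map_diff ring_map_sum ring_map_prod ring_map_power

lemma ring_map_comp: "ring_map f \<Longrightarrow> ring_map g \<Longrightarrow> ring_map (\<lambda>x. f (g x))"
  by (simp add: ring_map_def)

lemma ring_map_id: "ring_map id"
  by (simp add: ring_map_def)

lemma ring_map_mconst: "ring_map mconst"
  by (auto simp: ring_map_def mconst_def single_add mult_single)

lemma ring_map_to_frac: "ring_map (to_frac :: 'k::field mpoly \<Rightarrow> _)"
  by (auto simp: ring_map_def to_frac_def One_fract_def)

lemma ring_map_to_ac: "ring_map to_ac"
  by (simp add: ring_map_def)

lemma ring_map_const_frac: "ring_map (\<lambda>c. to_frac (mconst (c :: 'k::field)))"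
  by (rule ring_map_comp[OF ring_map_to_frac ring_map_mconst])

lemma to_frac_eq_iff [simp]: "to_frac p = to_frac q \<longleftrightarrow> p = q"
  by (simp add: to_frac_def eq_fract)

lemma to_frac_eq_0_iff [simp]: "to_frac p = 0 \<longleftrightarrow> p = 0"
  by (metis to_frac_eq_iff ring_map_0[OF ring_map_to_frac])

lemmas to_frac_simps = ring_map_simps[OF ring_map_to_frac]
lemmas mconst_simps = ring_map_simps[OF ring_map_mconst]

lemma mconst_eq_0_iff [simp]: "mconst c = 0 \<longleftrightarrow> c = 0"
  by (metis mconst_def lookup_single_eq lookup_zero single_zero)

lemma mvar_neq_0 [simp]: "mvar i \<noteq> (0 :: 'k::comm_ring_1 mpoly)"
  by (metis mvar_def lookup_single_eq lookup_zero zero_neq_one)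

section \<open>Sums of monomial terms and evaluation as a ring homomorphism\<close>

lemma mpoly_as_sum:
  fixes p :: "'a \<Rightarrow>\<^sub>0 'b::comm_monoid_add"
  assumes "finite S" "Poly_Mapping.keys p \<subseteq> S"
  shows "p = (\<Sum>m\<in>S. Poly_Mapping.single m (Poly_Mapping.lookup p m))"
proof (rule poly_mapping_eqI)
  fix k
  have "(\<Sum>m\<in>S. Poly_Mapping.lookup (Poly_Mapping.single m (Poly_Mapping.lookup p m)) k)
      = (\<Sum>m\<in>S. if m = k then Poly_Mapping.lookup p k else 0)"
    by (rule sum.cong) (auto simp: lookup_single when_def)
  also have "\<dots> = Poly_Mapping.lookup p k"
    using assms by (auto simp: in_keys_iff)
  finally show "Poly_Mapping.lookup p k
      = Poly_Mapping.lookup (\<Sum>m\<in>S. Poly_Mapping.single m (Poly_Mapping.lookup p m)) k"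
    by (simp add: lookup_sum)
qed

lemma mpoly_induct [case_names single add]:
  fixes p :: "'a \<Rightarrow>\<^sub>0 'b::comm_monoid_add"
  assumes "\<And>m c. P (Poly_Mapping.single m c)" "\<And>p q. P p \<Longrightarrow> P q \<Longrightarrow> P (p + q)"
  shows "P p"
proof -
  have "P (\<Sum>m\<in>S. Poly_Mapping.single m (Poly_Mapping.lookup p m))" if "finite S" for S
    \<comment> \<open>The empty sum is covered because zero is the term with coefficient 0 at an
      arbitrary monomial.\<close>
    using that by (induction S) (auto intro: assms simp: assms(1)[of undefined 0, simplified])
  then show ?thesis
    by (metis mpoly_as_sum finite_keys order_refl)
qed

definition monom_val :: "(nat \<Rightarrow> 'r::comm_ring_1) \<Rightarrow> (nat \<Rightarrow>\<^sub>0 nat) \<Rightarrow> 'r" where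
  "monom_val a m = (\<Prod>i\<in>Poly_Mapping.keys m. a i ^ Poly_Mapping.lookup m i)"

lemma monom_val_superset:
  assumes "finite S" "Poly_Mapping.keys m \<subseteq> S"
  shows "monom_val a m = (\<Prod>i\<in>S. a i ^ Poly_Mapping.lookup m i)"
  unfolding monom_val_def using assms
  by (intro prod.mono_neutral_left) (auto simp: in_keys_iff)

lemma keys_add_nat: "Poly_Mapping.keys (m + m' :: nat \<Rightarrow>\<^sub>0 nat) = Poly_Mapping.keys m \<union> Poly_Mapping.keys m'"
  by (auto simp: in_keys_iff lookup_add)

lemma monom_val_add: "monom_val a (m + m') = monom_val a m * monom_val a m'"
proof -
  let ?S = "Poly_Mapping.keys m \<union> Poly_Mapping.keys m'"
  show ?thesis
    by (subst (1 2 3) monom_val_superset[of ?S])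
      (auto simp: keys_add_nat lookup_add power_add prod.distrib)
qed

lemma monom_val_0 [simp]: "monom_val a 0 = 1"
  by (simp add: monom_val_def)

lemma monom_val_single [simp]: "monom_val a (Poly_Mapping.single i e) = a i ^ e"
  by (cases "e = 0") (simp_all add: monom_val_def)

lemma insertion_superset:
  assumes "\<phi> 0 = 0" "finite S" "Poly_Mapping.keys p \<subseteq> S"
  shows "insertion \<phi> a p = (\<Sum>m\<in>S. \<phi> (Poly_Mapping.lookup p m) * monom_val a m)"
  unfolding insertion_def monom_val_def using assms
  by (intro sum.mono_neutral_left) (auto simp: in_keys_iff)

lemma insertion_single:
  assumes "\<phi> 0 = 0"
  shows "insertion \<phi> a (Poly_Mapping.single m c) = \<phi> c * monom_val a m"
  by (subst insertion_superset[of _ "{m}"]) (auto simp: assms)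

lemma insertion_add:
  assumes "ring_map \<phi>"
  shows "insertion \<phi> a (p + q) = insertion \<phi> a p + insertion \<phi> a q"
proof -
  let ?S = "Poly_Mapping.keys p \<union> Poly_Mapping.keys q"
  note * = insertion_superset[of \<phi> ?S, OF ring_map_0[OF assms]]
  show ?thesis
    by (subst (1 2 3) *)
      (use keys_add[of p q] in \<open>auto simp: lookup_add ring_mapD[OF assms] distrib_right sum.distrib\<close>)
qed

text \<open>By additivity in each factor only products of two terms matter, and there the exponents
  add, so \<open>monom_val_add\<close> applies.\<close>

lemma insertion_mult:
  assumes "ring_map \<phi>"
  shows "insertion \<phi> a (p * q) = insertion \<phi> a p * insertion \<phi> a q"
proof (induction p rule: mpoly_induct)
  case (single m c)
  show ?case
    by (induction q rule: mpoly_induct)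
      (simp_all add: distrib_left distrib_right insertion_add assms mult_single insertion_single
        ring_mapD[OF assms] monom_val_add mult_ac)
qed (simp add: distrib_right insertion_add assms)

lemma insertion_mconst [simp]: "ring_map \<phi> \<Longrightarrow> insertion \<phi> a (mconst c) = \<phi> c"
  by (simp add: mconst_def insertion_single ring_mapD)

lemma insertion_mvar [simp]: "ring_map \<phi> \<Longrightarrow> insertion \<phi> a (mvar i) = a i"
  by (simp add: mvar_def insertion_single ring_mapD)

lemma ring_map_insertion: "ring_map \<phi> \<Longrightarrow> ring_map (insertion \<phi> a)"
  using insertion_mconst[of \<phi> a 1]
  by (simp add: ring_map_def insertion_mult insertion_add mconst_def)

lemmas insertion_simps = ring_map_simps[OF ring_map_insertion]

lemma ring_map_subst: "ring_map (subst g)"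
  unfolding subst_def by (rule ring_map_insertion[OF ring_map_mconst])

lemmas subst_simps = ring_map_simps[OF ring_map_subst]

lemma subst_mconst [simp]: "subst g (mconst c) = mconst c"
  by (simp add: subst_def ring_map_mconst)

lemma subst_mvar [simp]: "subst g (mvar i) = g i"
  by (simp add: subst_def ring_map_mconst)

text \<open>A homomorphism passes through the finite sums and products of an evaluation. All rules
  for iterated substitution come from this by choosing \<open>\<psi>\<close> to be another
  evaluation or \<open>to_frac\<close>.\<close>

lemma ring_map_of_insertion:
  "ring_map \<psi> \<Longrightarrow> \<psi> (insertion \<phi> a p) = insertion (\<lambda>c. \<psi> (\<phi> c)) (\<lambda>i. \<psi> (a i)) p"
  by (simp add: insertion_def ring_map_simps)

lemma insertion_subst:
  assumes "ring_map \<phi>"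
  shows "insertion \<phi> a (subst g p) = insertion \<phi> (\<lambda>i. insertion \<phi> a (g i)) p"
  by (simp add: subst_def ring_map_of_insertion[OF ring_map_insertion[OF assms]] assms)

lemma subst_subst: "subst g (subst f p) = subst (\<lambda>i. subst g (f i)) p"
  using insertion_subst[OF ring_map_mconst, of g f p] by (simp add: subst_def)

lemma to_frac_subst:
  "to_frac (subst g p) = insertion (\<lambda>c. to_frac (mconst c)) (\<lambda>i. to_frac (g i)) p"
  unfolding subst_def by (rule ring_map_of_insertion[OF ring_map_to_frac])

lemma insertion_cong:
  assumes "p \<in> polys_in V" "\<And>i. i \<in> V \<Longrightarrow> a i = b i"
  shows "insertion \<phi> a p = insertion \<phi> b p"
  unfolding insertion_def using assms
  by (intro sum.cong arg_cong2[of _ _ _ _ "(*)"] prod.cong) (auto simp: polys_in_def subset_eq)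

lemma subst_cong:
  "p \<in> polys_in V \<Longrightarrow> (\<And>i. i \<in> V \<Longrightarrow> a i = b i) \<Longrightarrow> subst a p = subst b p"
  unfolding subst_def by (rule insertion_cong)

lemma monom_val_mvar: "monom_val mvar m = Poly_Mapping.single m (1::'k::comm_ring_1)"
proof -
  have pow: "mvar i ^ e = Poly_Mapping.single (Poly_Mapping.single i e) (1::'k)" for i e
    by (induction e) (auto simp: mvar_def mult_single simp flip: single_add)
  have "(\<Prod>i\<in>S. mvar i ^ Poly_Mapping.lookup m i)
      = Poly_Mapping.single (\<Sum>i\<in>S. Poly_Mapping.single i (Poly_Mapping.lookup m i)) (1::'k)" if "finite S" for S
    using that by (induction S) (auto simp: pow mult_single)
  moreover have "m = (\<Sum>i\<in>Poly_Mapping.keys m. Poly_Mapping.single i (Poly_Mapping.lookup m i))"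
  proof (rule poly_mapping_eqI)
    fix k
    have "(\<Sum>i\<in>Poly_Mapping.keys m. Poly_Mapping.lookup (Poly_Mapping.single i (Poly_Mapping.lookup m i)) k)
      = (\<Sum>i\<in>Poly_Mapping.keys m. if i = k then Poly_Mapping.lookup m k else 0)"
      by (rule sum.cong) (auto simp: lookup_single when_def)
    then show "Poly_Mapping.lookup m k = Poly_Mapping.lookup
        (\<Sum>i\<in>Poly_Mapping.keys m. Poly_Mapping.single i (Poly_Mapping.lookup m i)) k"
      by (auto simp: lookup_sum in_keys_iff)
  qed
  ultimately show ?thesis
    by (metis finite_keys monom_val_def)
qed

lemma single_eq_mconst_mult: "Poly_Mapping.single m c = mconst c * monom_val mvar m"
  by (simp add: monom_val_mvar mconst_def mult_single)

lemma subst_mvar_id [simp]: "subst mvar p = p"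
proof (induction p rule: mpoly_induct)
  case (single m c)
  show ?case
    unfolding subst_def by (subst insertion_single) (simp_all add: mconst_simps single_eq_mconst_mult)
qed (simp add: subst_simps)

lemma subst_eq_self: "p \<in> polys_in V \<Longrightarrow> (\<And>i. i \<in> V \<Longrightarrow> g i = mvar i) \<Longrightarrow> subst g p = p"
  using subst_cong[of p V g mvar] by simp

lemma insertion_monom_degree:
  "(\<Prod>i\<in>Poly_Mapping.keys m. c ^ Poly_Mapping.lookup m i) = c ^ monom_degree m"
  by (simp add: monom_degree_def power_sum)

text \<open>Each monomial of a form of degree \<open>d\<close> contributes \<open>d\<close> factors
  \<open>c\<close>. Hence the values of forms of equal degree at a projective point depend on the
  chosen coordinates only up to a common factor.\<close>

lemma insertion_scale:
  assumes "homogeneous d p"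
  shows "insertion \<phi> (\<lambda>i. c * a i) p = c ^ d * insertion \<phi> a p"
  unfolding insertion_def sum_distrib_left using assms
  by (intro sum.cong)
    (auto simp: homogeneous_def power_mult_distrib prod.distrib insertion_monom_degree mult_ac)

section \<open>Polynomials in given variables and homogeneous polynomials\<close>

lemma polys_in_mconst: "mconst c \<in> polys_in V"
  by (auto simp: polys_in_def mconst_def split: if_splits)

lemma polys_in_0: "0 \<in> polys_in V" and polys_in_1: "1 \<in> polys_in V"
  by (auto simp: polys_in_def)

lemma polys_in_mvar: "i \<in> V \<Longrightarrow> mvar i \<in> polys_in V"
  by (auto simp: polys_in_def mvar_def)

lemma polys_in_add: "p \<in> polys_in V \<Longrightarrow> q \<in> polys_in V \<Longrightarrow> p + q \<in> polys_in V"
  unfolding polys_in_def using keys_add[of p q] by blast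

lemma polys_in_mult: "p \<in> polys_in V \<Longrightarrow> q \<in> polys_in V \<Longrightarrow> p * q \<in> polys_in V"
  unfolding polys_in_def using keys_mult[of p q] by (fastforce simp: keys_add_nat)

lemma polys_in_uminus: "p \<in> polys_in V \<Longrightarrow> - p \<in> polys_in V"
  using polys_in_mult[OF polys_in_mconst[of "-1"], of p V] by (simp add: mconst_simps)

lemma polys_in_diff: "p \<in> polys_in V \<Longrightarrow> q \<in> polys_in V \<Longrightarrow> p - q \<in> polys_in V"
  using polys_in_add[OF _ polys_in_uminus, of p V q] by simp

lemma polys_in_sum: "(\<And>i. i \<in> A \<Longrightarrow> f i \<in> polys_in V) \<Longrightarrow> (\<Sum>i\<in>A. f i) \<in> polys_in V"
  by (induction A rule: infinite_finite_induct) (auto intro: polys_in_add polys_in_0)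

lemma polys_in_prod: "(\<And>i. i \<in> A \<Longrightarrow> f i \<in> polys_in V) \<Longrightarrow> (\<Prod>i\<in>A. f i) \<in> polys_in V"
  by (induction A rule: infinite_finite_induct) (auto intro: polys_in_mult polys_in_1)

lemma polys_in_power: "p \<in> polys_in V \<Longrightarrow> p ^ e \<in> polys_in V"
  by (induction e) (auto intro: polys_in_mult polys_in_1)

lemmas polys_in_intros = polys_in_mconst polys_in_0 polys_in_1 polys_in_mvar polys_in_add
  polys_in_mult polys_in_uminus polys_in_diff polys_in_sum polys_in_prod polys_in_power

lemma polys_in_mono: "V \<subseteq> W \<Longrightarrow> p \<in> polys_in V \<Longrightarrow> p \<in> polys_in W"
  by (auto simp: polys_in_def)

lemma polys_in_subst:
  assumes "p \<in> polys_in V" "\<And>i. i \<in> V \<Longrightarrow> g i \<in> polys_in W"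
  shows "subst g p \<in> polys_in W"
  unfolding subst_def insertion_def
proof (intro polys_in_sum polys_in_mult polys_in_mconst polys_in_prod polys_in_power)
  fix m i assume "m \<in> Poly_Mapping.keys p" "i \<in> Poly_Mapping.keys m"
  with assms show "g i \<in> polys_in W" by (auto simp: polys_in_def[of V])
qed

text \<open>Monomials are built by multiplying a constant by one variable at a time. This shape fits
  sets closed under sums and under multiplication by a coordinate, as needed for
  \<open>addable\<close> later.\<close>

lemma polys_in_induct [consumes 1, case_names mconst mvar_mult add]:
  assumes p: "p \<in> polys_in V"
    and c: "\<And>c. P (mconst c)"
    and v: "\<And>i q. i \<in> V \<Longrightarrow> q \<in> polys_in V \<Longrightarrow> P q \<Longrightarrow> P (mvar i * q)"
    and a: "\<And>p q. p \<in> polys_in V \<Longrightarrow> q \<in> polys_in V \<Longrightarrow> P p \<Longrightarrow> P q \<Longrightarrow> P (p + q)"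
  shows "P p"
proof -
  \<comment> \<open>Membership is carried along with \<open>P\<close>, since the rules for products
    and sums ask for it.\<close>
  define Q where "Q p \<longleftrightarrow> p \<in> polys_in V \<and> P p" for p
  have pow: "Q (mvar i ^ e * q)" if "i \<in> V" "Q q" for i q e
    using that by (induction e) (auto simp: Q_def mult.assoc intro!: v polys_in_intros)
  have single: "Q (mconst c * monom_val mvar m)" if "Poly_Mapping.keys m \<subseteq> V" for m c
  proof -
    have "Q (mconst c * (\<Prod>i\<in>S. mvar i ^ Poly_Mapping.lookup m i))" if "finite S" "S \<subseteq> V" for S
      using that
    proof (induction S)
      case (insert i S)
      then have "Q (mvar i ^ Poly_Mapping.lookup m i * (mconst c * (\<Prod>i\<in>S. mvar i ^ Poly_Mapping.lookup m i)))"
        by (intro pow) auto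
      with insert show ?case by (simp add: mult_ac)
    qed (simp add: Q_def c polys_in_mconst)
    with that show ?thesis unfolding monom_val_def by simp
  qed
  have "Q (\<Sum>m\<in>S. Poly_Mapping.single m (Poly_Mapping.lookup p m))"
    if "finite S" "S \<subseteq> Poly_Mapping.keys p" for S
    using that
  proof (induction S)
    case empty
    show ?case using c[of 0] by (simp add: Q_def mconst_simps polys_in_0)
  next
    case (insert m S)
    have "Q (Poly_Mapping.single m (Poly_Mapping.lookup p m))"
      using insert.prems p unfolding single_eq_mconst_mult by (intro single) (auto simp: polys_in_def)
    with insert show ?case by (auto simp: Q_def intro: a polys_in_add)
  qed
  from this[of "Poly_Mapping.keys p"] show ?thesis
    unfolding Q_def using mpoly_as_sum[of "Poly_Mapping.keys p" p] by simp
qed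

section \<open>Degrees of monomials and homogeneity\<close>

lemma monom_degree_superset:
  assumes "finite S" "Poly_Mapping.keys m \<subseteq> S"
  shows "monom_degree m = (\<Sum>i\<in>S. Poly_Mapping.lookup m i)"
  unfolding monom_degree_def using assms
  by (intro sum.mono_neutral_left) (auto simp: in_keys_iff)

lemma monom_degree_add: "monom_degree (m + m') = monom_degree m + monom_degree m'"
proof -
  let ?S = "Poly_Mapping.keys m \<union> Poly_Mapping.keys m'"
  show ?thesis
    by (subst (1 2 3) monom_degree_superset[of ?S])
      (auto simp: keys_add_nat lookup_add sum.distrib)
qed

lemma homogeneous_0: "homogeneous d 0"
  by (simp add: homogeneous_def)

lemma homogeneous_mconst: "homogeneous 0 (mconst c)"
  by (auto simp: homogeneous_def mconst_def monom_degree_def split: if_splits)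

lemma homogeneous_mvar: "homogeneous (Suc 0) (mvar i)"
  by (auto simp: homogeneous_def mvar_def monom_degree_def)

lemma homogeneous_add: "homogeneous d p \<Longrightarrow> homogeneous d q \<Longrightarrow> homogeneous d (p + q)"
  unfolding homogeneous_def using keys_add[of p q] by blast

lemma homogeneous_mult: "homogeneous d p \<Longrightarrow> homogeneous e q \<Longrightarrow> homogeneous (d + e) (p * q)"
  unfolding homogeneous_def using keys_mult[of p q] by (fastforce simp: monom_degree_add)

lemma homogeneous_mconst_mult: "homogeneous d p \<Longrightarrow> homogeneous d (mconst c * p)"
  using homogeneous_mult[OF homogeneous_mconst] by fastforce

lemma homogeneous_sum: "(\<And>i. i \<in> A \<Longrightarrow> homogeneous d (f i)) \<Longrightarrow> homogeneous d (\<Sum>i\<in>A. f i)"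
  by (induction A rule: infinite_finite_induct) (auto intro: homogeneous_add homogeneous_0)

lemma homogeneous_1: "homogeneous 0 1"
  using homogeneous_mconst[of 1] by (simp add: mconst_simps)

lemma homogeneous_power: "homogeneous d p \<Longrightarrow> homogeneous (d * e) (p ^ e)"
  by (induction e) (auto intro: homogeneous_mult homogeneous_1)

lemma homogeneous_prod:
  "(\<And>i. i \<in> A \<Longrightarrow> homogeneous (d i) (f i)) \<Longrightarrow> homogeneous (\<Sum>i\<in>A. d i) (\<Prod>i\<in>A. f i)"
  by (induction A rule: infinite_finite_induct) (auto intro: homogeneous_mult homogeneous_1)

lemma homogeneous_subst:
  assumes "p \<in> polys_in V" "homogeneous d p" "\<And>i. i \<in> V \<Longrightarrow> homogeneous e (g i)"
  shows "homogeneous (d * e) (subst g p)"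
  unfolding subst_def insertion_def
proof (intro homogeneous_sum homogeneous_mconst_mult)
  fix m assume m: "m \<in> Poly_Mapping.keys p"
  have "homogeneous (\<Sum>i\<in>Poly_Mapping.keys m. e * Poly_Mapping.lookup m i)
      (\<Prod>i\<in>Poly_Mapping.keys m. g i ^ Poly_Mapping.lookup m i)"
    using assms(1,3) m by (intro homogeneous_prod homogeneous_power) (auto simp: polys_in_def)
  also have "(\<Sum>i\<in>Poly_Mapping.keys m. e * Poly_Mapping.lookup m i) = d * e"
    using assms(2) m by (simp add: homogeneous_def monom_degree_def mult.commute[of d] flip: sum_distrib_left)
  finally show "homogeneous (d * e) (\<Prod>i\<in>Poly_Mapping.keys m. g i ^ Poly_Mapping.lookup m i)" .
qed

lemma monom_degree_eq_0: "monom_degree m = 0 \<longleftrightarrow> m = 0"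
  by (auto simp: monom_degree_def in_keys_iff intro: poly_mapping_eqI)

lemma monom_degree_eq_1:
  assumes "monom_degree m = 1"
  obtains j where "m = Poly_Mapping.single j 1"
proof -
  obtain j where j: "j \<in> Poly_Mapping.keys m"
    using assms by (fastforce simp: monom_degree_def)
  have *: "Poly_Mapping.lookup m j + (\<Sum>i\<in>Poly_Mapping.keys m - {j}. Poly_Mapping.lookup m i) = 1"
    using assms j by (simp add: monom_degree_def sum.remove)
  moreover have "Poly_Mapping.lookup m j \<ge> 1" using j by (simp add: in_keys_iff Suc_leI)
  ultimately have 1: "Poly_Mapping.lookup m j = 1"
    and 0: "(\<Sum>i\<in>Poly_Mapping.keys m - {j}. Poly_Mapping.lookup m i) = 0" by linarith+
  have "m = Poly_Mapping.single j 1"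
  proof (rule poly_mapping_eqI)
    fix k show "Poly_Mapping.lookup m k = Poly_Mapping.lookup (Poly_Mapping.single j 1) k"
      using 0 1 by (cases "k = j") (auto simp: lookup_single when_def in_keys_iff)
  qed
  then show ?thesis by (rule that)
qed

text \<open>A monomial of degree at most 1 is either 1 or a single variable, so the coefficients at
  these determine the polynomial.\<close>

lemma affine_expansion:
  assumes "p \<in> polys_in V" "finite V" "\<And>m. m \<in> Poly_Mapping.keys p \<Longrightarrow> monom_degree m \<le> 1"
  shows "p = mconst (Poly_Mapping.lookup p 0)
      + (\<Sum>j\<in>V. mconst (Poly_Mapping.lookup p (Poly_Mapping.single j 1)) * mvar j)"
proof -
  let ?e = "\<lambda>j::nat. Poly_Mapping.single j (1::nat)"
  have inj: "inj_on ?e V" 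
    by (rule inj_onI) (metis keys_single one_neq_zero singleton_inject)
  have nz: "0 \<notin> ?e ` V"
    by (auto dest!: arg_cong[of 0 _ Poly_Mapping.keys])
  have "Poly_Mapping.keys p \<subseteq> insert 0 (?e ` V)"
  proof
    fix m assume m: "m \<in> Poly_Mapping.keys p"
    show "m \<in> insert 0 (?e ` V)"
    proof (cases "m = 0")
      case False
      with assms(3)[OF m] monom_degree_eq_0[of m] have "monom_degree m = 1" by linarith
      then obtain j where "m = ?e j" by (rule monom_degree_eq_1)
      moreover have "Poly_Mapping.keys m \<subseteq> V" using assms(1) m by (auto simp: polys_in_def)
      ultimately show ?thesis by auto
    qed simp
  qed
  then have "p = (\<Sum>m\<in>insert 0 (?e ` V). Poly_Mapping.single m (Poly_Mapping.lookup p m))"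
    using assms(2) by (intro mpoly_as_sum) auto
  also have "\<dots> = mconst (Poly_Mapping.lookup p 0)
      + (\<Sum>j\<in>V. mconst (Poly_Mapping.lookup p (?e j)) * mvar j)"
    using assms(2) inj nz
    by (simp add: mconst_def mvar_def mult_single sum.reindex)
  finally show ?thesis .
qed

lemma linear_form_expansion:
  assumes "p \<in> polys_in V" "finite V" "homogeneous 1 p"
  shows "p = (\<Sum>j\<in>V. mconst (Poly_Mapping.lookup p (Poly_Mapping.single j 1)) * mvar j)"
proof -
  have "Poly_Mapping.lookup p 0 = 0"
    using assms(3) monom_degree_eq_0[of 0] by (force simp: homogeneous_def in_keys_iff)
  moreover have "monom_degree m \<le> 1" if "m \<in> Poly_Mapping.keys p" for m
    using assms(3) that by (simp add: homogeneous_def)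
  ultimately show ?thesis
    using affine_expansion[OF assms(1,2)] by (simp add: mconst_simps)
qed

section \<open>Composition of rational maps\<close>

lemma proportionalD:
  assumes "proportional n a b"
  shows "\<exists>i\<le>n. a i \<noteq> 0" "\<exists>i\<le>n. b i \<noteq> 0"
    "\<And>i j. i \<le> n \<Longrightarrow> j \<le> n \<Longrightarrow> a i * b j = a j * b i"
  using assms unfolding proportional_def by blast+

lemma proportional_refl: "\<exists>i\<le>n. a i \<noteq> 0 \<Longrightarrow> proportional n a a"
  by (simp add: proportional_def mult.commute)

lemma proportional_sym: "proportional n a b \<Longrightarrow> proportional n b a"
  by (simp add: proportional_def mult.commute)

text \<open>The middle tuple is nonzero by definition of \<open>proportional\<close>, so it has an
  entry \<open>b m\<close> that can be cancelled after cross multiplication.\<close>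

lemma proportional_trans:
  assumes "proportional n a b" "proportional n b c"
  shows "proportional n a c"
proof -
  obtain m where m: "m \<le> n" "b m \<noteq> 0" using assms(1) by (auto simp: proportional_def)
  have "a i * c j = a j * c i" if "i \<le> n" "j \<le> n" for i j
  proof -
    have "b m * (a i * c j) = a i * (b m * c j)" by (simp add: mult_ac)
    also have "\<dots> = a i * b j * c m"
      using assms(2) m that by (simp add: proportional_def mult_ac)
    also have "\<dots> = a j * (b i * c m)"
      using assms(1) that by (simp add: proportional_def mult_ac)
    also have "\<dots> = b m * (a j * c i)"
      using assms(2) m that by (simp add: proportional_def mult_ac)
    finally show ?thesis using m(2) by simp
  qed
  with assms show ?thesis by (auto simp: proportional_def)
qed

lemma proportional_cong:
  "(\<And>i. i \<le> n \<Longrightarrow> a i = a' i) \<Longrightarrow> (\<And>i. i \<le> n \<Longrightarrow> b i = b' i) \<Longrightarrow>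
   proportional n a b \<longleftrightarrow> proportional n a' b'"
  by (simp add: proportional_def cong: conj_cong)

lemma proportional_scale:
  assumes "c \<noteq> 0" "\<exists>i\<le>n. a i \<noteq> 0" "\<And>i. i \<le> n \<Longrightarrow> b i = c * a i"
  shows "proportional n b a"
  using assms by (auto simp: proportional_def mult_ac)

lemma proportional_nonzero_iff:
  assumes "proportional n a b" "i \<le> n"
  shows "a i \<noteq> 0 \<longleftrightarrow> b i \<noteq> 0"
proof -
  have "b i \<noteq> 0" if "proportional n a b" "a i \<noteq> 0" for a b :: "nat \<Rightarrow> 'a"
  proof
    assume "b i = 0"
    with that have "\<forall>j\<le>n. a i * b j = 0" using assms(2) by (simp add: proportional_def)
    with that show False by (auto simp: proportional_def)
  qed
  from this[of a b] this[of b a] assms proportional_sym show ?thesis by blast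
qed

lemma rat_map_eqI: "proportional n \<phi> \<psi> \<Longrightarrow> rat_map n \<phi> = rat_map n \<psi>"
  unfolding rat_map_def
  using proportional_trans[of n _ \<phi> \<psi>] proportional_trans[of n _ \<psi> \<phi>] proportional_sym[of n \<phi> \<psi>]
  by auto

lemma formsE:
  assumes "f \<in> forms n"
  obtains d where "\<And>i. i \<le> n \<Longrightarrow> f i \<in> polys_in {0..n}" "\<And>i. i \<le> n \<Longrightarrow> homogeneous d (f i)"
    "\<exists>i\<le>n. f i \<noteq> 0"
  using assms by (auto simp: forms_def)

lemma rat_map_self: "f \<in> forms n \<Longrightarrow> f \<in> rat_map n (\<lambda>i. to_frac (f i))"
  by (auto simp: rat_map_def forms_def intro!: proportional_refl)

lemma proportional_to_frac:
  "proportional n (\<lambda>i. to_frac (f i)) (\<lambda>i. to_frac (g i)) \<longleftrightarrow> proportional n f g"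
  by (simp add: proportional_def flip: to_frac_simps)

lemma rat_map_memD:
  assumes "f \<in> rat_map n \<phi>"
  shows "f \<in> forms n" "proportional n (\<lambda>i. to_frac (f i)) \<phi>"
    "rat_map n \<phi> = rat_map n (\<lambda>i. to_frac (f i))"
  using assms rat_map_eqI[OF proportional_sym] by (auto simp: rat_map_def)

text \<open>The tuples \<open>b m * a\<close> and \<open>a m * b\<close> coincide, and homogeneity
  extracts the nonzero factors \<open>b m ^ d\<close> and \<open>a m ^ d\<close> from the values of
  the forms. So forms act on projective points wherever their values do not all vanish.\<close>

lemma insertion_proportional:
  assumes f: "f \<in> forms n" and ab: "proportional n a b" and \<phi>: "ring_map \<phi>"
    and nz: "\<exists>i\<le>n. insertion \<phi> b (f i) \<noteq> 0"
  shows "proportional n (\<lambda>i. insertion \<phi> a (f i)) (\<lambda>i. insertion \<phi> b (f i))"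
proof -
  from f obtain d where f: "\<And>i. i \<le> n \<Longrightarrow> f i \<in> polys_in {0..n}" "\<And>i. i \<le> n \<Longrightarrow> homogeneous d (f i)"
    by (rule formsE) blast
  obtain m where m: "m \<le> n" "b m \<noteq> 0" using ab by (auto simp: proportional_def)
  then have am: "a m \<noteq> 0" using proportional_nonzero_iff[OF ab] by blast
  have *: "b m ^ d * insertion \<phi> a (f i) = a m ^ d * insertion \<phi> b (f i)" if i: "i \<le> n" for i
  proof -
    have "insertion \<phi> (\<lambda>j. b m * a j) (f i) = insertion \<phi> (\<lambda>j. a m * b j) (f i)"
      using ab m by (intro insertion_cong[OF f(1)[OF i]]) (auto simp: proportional_def mult_ac)
    then show ?thesis by (simp add: insertion_scale[OF f(2)[OF i]])
  qed
  have "insertion \<phi> a (f i) * insertion \<phi> b (f j) = insertion \<phi> a (f j) * insertion \<phi> b (f i)"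
    if "i \<le> n" "j \<le> n" for i j
  proof -
    have "b m ^ d * (insertion \<phi> a (f i) * insertion \<phi> b (f j))
        = (b m ^ d * insertion \<phi> a (f i)) * insertion \<phi> b (f j)"
      by (simp only: mult.assoc)
    also have "\<dots> = (a m ^ d * insertion \<phi> b (f j)) * insertion \<phi> b (f i)"
      by (simp only: *[OF that(1)] mult_ac)
    also have "\<dots> = b m ^ d * (insertion \<phi> a (f j) * insertion \<phi> b (f i))"
      by (simp only: *[OF that(2), symmetric] mult.assoc)
    finally show ?thesis using m(2) by simp
  qed
  moreover from nz obtain k where k: "k \<le> n" "insertion \<phi> b (f k) \<noteq> 0" by blast
  then have "b m ^ d * insertion \<phi> a (f k) \<noteq> 0" using * am by simp
  ultimately show ?thesis using k nz by (auto simp: proportional_def)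
qed

lemma subst_nonzero_proportional:
  assumes f: "f \<in> forms n" and gg: "proportional n g' g"
    and nz: "\<exists>i\<le>n. subst g (f i) \<noteq> 0"
  shows "proportional n (\<lambda>i. subst g' (f i)) (\<lambda>i. subst g (f i))"
  using insertion_proportional[OF f gg ring_map_mconst] nz by (simp add: subst_def)

text \<open>The pair \<open>f\<close>, \<open>g\<close> itself contributes the right-hand side to
  the union, and any other pair of representatives contributes either the same map or
  nothing.\<close>

lemma rat_comp_eq:
  assumes f: "f \<in> forms n" and g: "g \<in> forms n" and nz: "\<exists>i\<le>n. subst g (f i) \<noteq> 0"
  shows "rat_comp n (rat_map n (\<lambda>i. to_frac (f i))) (rat_map n (\<lambda>i. to_frac (g i)))
    = rat_map n (\<lambda>i. to_frac (subst g (f i)))"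
proof
  show "rat_map n (\<lambda>i. to_frac (subst g (f i)))
      \<subseteq> rat_comp n (rat_map n (\<lambda>i. to_frac (f i))) (rat_map n (\<lambda>i. to_frac (g i)))"
    unfolding rat_comp_def using rat_map_self[OF f] rat_map_self[OF g] by blast
next
  show "rat_comp n (rat_map n (\<lambda>i. to_frac (f i))) (rat_map n (\<lambda>i. to_frac (g i)))
      \<subseteq> rat_map n (\<lambda>i. to_frac (subst g (f i)))"
  proof
    fix h assume "h \<in> rat_comp n (rat_map n (\<lambda>i. to_frac (f i))) (rat_map n (\<lambda>i. to_frac (g i)))"
    then obtain f' g' where f': "f' \<in> rat_map n (\<lambda>i. to_frac (f i))"
      and g': "g' \<in> rat_map n (\<lambda>i. to_frac (g i))"
      and h: "h \<in> rat_map n (\<lambda>i. to_frac (subst g' (f' i)))"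
      by (auto simp: rat_comp_def)
    have ff: "proportional n f' f" and gg: "proportional n g' g"
      using rat_map_memD(2)[OF f'] rat_map_memD(2)[OF g'] by (simp_all add: proportional_to_frac)
    have 1: "proportional n (\<lambda>i. subst g' (f i)) (\<lambda>i. subst g (f i))"
      by (rule subst_nonzero_proportional[OF f gg nz])
    \<comment> \<open>Membership of \<open>h\<close> in the rational map of this tuple already
      forces the tuple to be nonzero.\<close>
    have "\<exists>i\<le>n. subst g' (f' i) \<noteq> 0"
      using proportionalD(1)[OF rat_map_memD(2)[OF h]] proportionalD(2)[OF rat_map_memD(2)[OF h]] by auto
    moreover have "subst g' (f' i) * subst g' (f j) = subst g' (f' j) * subst g' (f i)"
      if "i \<le> n" "j \<le> n" for i j
      using ff that by (simp add: proportional_def flip: subst_simps)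
    ultimately have "proportional n (\<lambda>i. subst g' (f' i)) (\<lambda>i. subst g' (f i))"
      using 1 by (simp add: proportional_def)
    then have "proportional n (\<lambda>i. subst g' (f' i)) (\<lambda>i. subst g (f i))"
      using 1 proportional_trans by blast
    with h show "h \<in> rat_map n (\<lambda>i. to_frac (subst g (f i)))"
      using rat_map_eqI by (metis proportional_to_frac)
  qed
qed

lemma forms_subst:
  assumes f: "f \<in> forms n" and g: "g \<in> forms n" and nz: "\<exists>i\<le>n. subst g (f i) \<noteq> 0"
  shows "(\<lambda>i. subst g (f i)) \<in> forms n"
proof -
  from f obtain d where f: "\<And>i. i \<le> n \<Longrightarrow> f i \<in> polys_in {0..n}" "\<And>i. i \<le> n \<Longrightarrow> homogeneous d (f i)"
    by (rule formsE) blast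
  from g obtain e where g: "\<And>i. i \<le> n \<Longrightarrow> g i \<in> polys_in {0..n}" "\<And>i. i \<le> n \<Longrightarrow> homogeneous e (g i)"
    by (rule formsE) blast
  have "homogeneous (d * e) (subst g (f i))" if "i \<le> n" for i
    by (rule homogeneous_subst[OF f(1)[OF that] f(2)[OF that]]) (auto intro: g)
  moreover have "subst g (f i) \<in> polys_in {0..n}" if "i \<le> n" for i
    by (rule polys_in_subst[OF f(1)[OF that]]) (auto intro: g)
  ultimately show ?thesis using nz by (auto simp: forms_def)
qed

lemma mvar_forms: "mvar \<in> forms n"
proof -
  have "\<forall>i\<le>n. homogeneous (Suc 0) (mvar i)" by (simp add: homogeneous_mvar)
  then show ?thesis by (auto simp: forms_def intro: polys_in_mvar)
qed

section \<open>Linear automorphisms of projective space\<close>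

text \<open>An invertible linear change of homogeneous coordinates is stored together with its
  inverse, so that passing to the inverse is only an exchange of the arguments.\<close>

definition linear_pair :: "nat \<Rightarrow> (nat \<Rightarrow> 'k::field mpoly) \<Rightarrow> (nat \<Rightarrow> 'k mpoly) \<Rightarrow> bool" where
  "linear_pair n l l' \<longleftrightarrow>
     (\<forall>i\<le>n. l i \<in> polys_in {0..n} \<and> homogeneous 1 (l i) \<and> subst l (l' i) = mvar i) \<and>
     (\<forall>i\<le>n. l' i \<in> polys_in {0..n} \<and> homogeneous 1 (l' i) \<and> subst l' (l i) = mvar i)"

lemma linear_pair_sym: "linear_pair n l l' \<Longrightarrow> linear_pair n l' l"
  by (auto simp: linear_pair_def)

text \<open>The coordinates of \<open>b\<close> are recovered from the values of \<open>l\<close> by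
  the linear forms \<open>l'\<close>, which vanish at the origin.\<close>

lemma linear_pair_nonzero:
  assumes "linear_pair n l l'" "ring_map \<phi>" "\<exists>i\<le>n. b i \<noteq> 0"
  shows "\<exists>i\<le>n. insertion \<phi> b (l i) \<noteq> 0"
proof (rule ccontr)
  assume "\<not> ?thesis"
  then have z: "insertion \<phi> b (l i) = 0" if "i \<le> n" for i using that by blast
  have "b j = 0" if j: "j \<le> n" for j
  proof -
    have "b j = insertion \<phi> b (subst l (l' j))"
      using assms(1,2) j by (simp add: linear_pair_def)
    also have "\<dots> = insertion \<phi> (\<lambda>i. insertion \<phi> b (l i)) (l' j)"
      by (rule insertion_subst[OF assms(2)])
    \<comment> \<open>Written as multiples by 0, the zero values allow homogeneity of degree 1 to
      extract the factor 0.\<close>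
    also have "\<dots> = insertion \<phi> (\<lambda>i. 0 * insertion \<phi> b (l i)) (l' j)"
      using assms(1) j by (intro insertion_cong[of _ "{0..n}"]) (auto simp: linear_pair_def z)
    also have "\<dots> = 0"
      using assms(1) j by (subst insertion_scale[of 1]) (auto simp: linear_pair_def)
    finally show ?thesis .
  qed
  with assms(3) show False by blast
qed

lemma linear_pair_subst_nonzero:
  "linear_pair n l l' \<Longrightarrow> \<exists>i\<le>n. g i \<noteq> 0 \<Longrightarrow> \<exists>i\<le>n. subst g (l i) \<noteq> 0"
  unfolding subst_def by (rule linear_pair_nonzero[OF _ ring_map_mconst])

lemma linear_pair_forms:
  assumes "linear_pair n l l'"
  shows "l \<in> forms n"
proof -
  have "l 0 \<noteq> 0" using assms unfolding linear_pair_def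
    using subst_simps(4)[of l'] mvar_neq_0[of 0] by (metis le0)
  with assms show ?thesis unfolding forms_def linear_pair_def by blast
qed

definition rat_of :: "nat \<Rightarrow> (nat \<Rightarrow> 'k::field mpoly) \<Rightarrow> (nat \<Rightarrow> 'k mpoly) set" where
  "rat_of n f = rat_map n (\<lambda>i. to_frac (f i))"

lemma rat_of_eqI: "proportional n f g \<Longrightarrow> rat_of n f = rat_of n g"
  unfolding rat_of_def by (rule rat_map_eqI) (simp add: proportional_to_frac)

lemma rat_of_eqD:
  assumes "f \<in> forms n" "rat_of n f = rat_of n g"
  shows "proportional n f g"
  using rat_map_memD(2)[of f n "\<lambda>i. to_frac (g i)"] rat_map_self[OF assms(1)] assms(2)
  by (simp add: rat_of_def proportional_to_frac)

lemma rat_comp_linear: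
  assumes "linear_pair n l l'" "g \<in> forms n"
  shows "rat_comp n (rat_of n l) (rat_of n g) = rat_of n (\<lambda>i. subst g (l i))"
  unfolding rat_of_def
proof (rule rat_comp_eq[OF linear_pair_forms[OF assms(1)] assms(2)])
  show "\<exists>i\<le>n. subst g (l i) \<noteq> 0"
    using assms(2) by (intro linear_pair_subst_nonzero[OF assms(1)]) (simp add: forms_def)
qed

lemma rat_comp_linear_inverse:
  assumes "linear_pair n l l'"
  shows "rat_comp n (rat_of n l) (rat_of n l') = rat_id n"
proof -
  have "rat_comp n (rat_of n l) (rat_of n l') = rat_of n (\<lambda>i. subst l' (l i))"
    by (rule rat_comp_linear[OF assms linear_pair_forms[OF linear_pair_sym[OF assms]]])
  also have "\<dots> = rat_of n mvar"
    using assms by (intro rat_of_eqI proportional_scale[of 1])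
      (auto simp: linear_pair_def intro: exI[of _ 0])
  finally show ?thesis by (simp add: rat_of_def rat_id_def)
qed

lemma rat_of_in_rat_maps: "f \<in> forms n \<Longrightarrow> rat_of n f \<in> rat_maps n"
  unfolding rat_maps_def rat_of_def by blast

lemma linear_in_Bir:
  assumes "linear_pair n l l'"
  shows "rat_of n l \<in> carrier (Bir n)"
  using rat_of_in_rat_maps[OF linear_pair_forms[OF assms]]
    rat_of_in_rat_maps[OF linear_pair_forms[OF linear_pair_sym[OF assms]]]
    rat_comp_linear_inverse[OF assms] rat_comp_linear_inverse[OF linear_pair_sym[OF assms]]
  by (auto simp: Bir_def)

text \<open>The inverse in \<open>Bir n\<close> is a definite description, so uniqueness is checked
  directly: if \<open>l\<close> after \<open>g\<close> is the identity, then applying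
  \<open>l'\<close> to both sides leaves \<open>g\<close> proportional to \<open>l'\<close>.\<close>

lemma linear_inv_Bir:
  assumes l: "linear_pair n l l'"
  shows "inv\<^bsub>Bir n\<^esub> (rat_of n l) = rat_of n l'"
  unfolding m_inv_def
proof (rule the_equality)
  show "rat_of n l' \<in> carrier (Bir n) \<and> rat_of n l \<otimes>\<^bsub>Bir n\<^esub> rat_of n l' = \<one>\<^bsub>Bir n\<^esub>
      \<and> rat_of n l' \<otimes>\<^bsub>Bir n\<^esub> rat_of n l = \<one>\<^bsub>Bir n\<^esub>"
    using linear_in_Bir[OF linear_pair_sym[OF l]] rat_comp_linear_inverse[OF l]
      rat_comp_linear_inverse[OF linear_pair_sym[OF l]]
    by (simp add: Bir_def)
next
  fix G assume G: "G \<in> carrier (Bir n) \<and> rat_of n l \<otimes>\<^bsub>Bir n\<^esub> G = \<one>\<^bsub>Bir n\<^esub>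
      \<and> G \<otimes>\<^bsub>Bir n\<^esub> rat_of n l = \<one>\<^bsub>Bir n\<^esub>"
  then obtain g where g: "g \<in> forms n" "G = rat_of n g"
    by (auto simp: Bir_def rat_maps_def rat_of_def)
  have "rat_of n (\<lambda>i. subst g (l i)) = rat_of n mvar"
    using G rat_comp_linear[OF l g(1)] by (simp add: Bir_def g(2) rat_id_def rat_of_def)
  then have *: "proportional n (\<lambda>i. subst g (l i)) mvar"
    by (intro proportional_sym[OF rat_of_eqD[OF mvar_forms]]) simp
  have l': "l' \<in> forms n" by (rule linear_pair_forms[OF linear_pair_sym[OF l]])
  have "proportional n (\<lambda>j. subst (\<lambda>i. subst g (l i)) (l' j)) (\<lambda>j. subst mvar (l' j))"
    using l' by (intro subst_nonzero_proportional[OF l' *]) (auto simp: forms_def)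
  moreover have "subst (\<lambda>i. subst g (l i)) (l' j) = g j" if "j \<le> n" for j
    using l that by (simp add: linear_pair_def flip: subst_subst)
  ultimately have "proportional n g l'"
    by (subst proportional_cong[of n _ "\<lambda>j. subst (\<lambda>i. subst g (l i)) (l' j)"]) auto
  then show "G = rat_of n l'"
    using g(2) rat_of_eqI by blast
qed

text \<open>Every coordinate is a linear combination of the forms \<open>l i\<close>. If all of
  these lay in \<open>P\<close>, then so would all coordinates, which is excluded for a point of
  \<open>Proj\<close>.\<close>

lemma linear_everywhere_defined:
  assumes l: "linear_pair n l l'"
  shows "everywhere_defined n (rat_of n l)"
  unfolding everywhere_defined_def
proof
  fix P :: "'a mpoly set" assume "P \<in> proj_points n"
  then have P: "primeideal P (poly_ring {0..n})" and "\<exists>i\<le>n. mvar i \<notin> P"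
    by (auto simp: proj_points_def)
  then obtain j where j: "j \<le> n" "mvar j \<notin> P" by blast
  from P have ideal: "ideal P (poly_ring {0..n})" by (simp add: primeideal_def)
  then have subgroup: "additive_subgroup P (poly_ring {0..n})" by (rule ideal.axioms(1))
  have add: "p + q \<in> P" if "p \<in> P" "q \<in> P" for p q
    using additive_subgroup.a_closed[OF subgroup that] by (simp add: poly_ring_def)
  have mult: "p * q \<in> P" if "q \<in> P" "p \<in> polys_in {0..n}" for p q
    using ideal.I_l_closed[OF ideal that(1), of p] that(2) by (simp add: poly_ring_def)
  have zero: "0 \<in> P" using additive_subgroup.zero_closed[OF subgroup] by (simp add: poly_ring_def)
  have "\<exists>i\<le>n. l i \<notin> P"
  proof (rule ccontr)
    assume "\<not> ?thesis"
    then have lP: "l i \<in> P" if "i \<le> n" for i using that by blast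
    obtain c where c: "l' j = (\<Sum>i\<in>{0..n}. mconst (c i) * mvar i)"
      using linear_form_expansion[of "l' j" "{0..n}"] l j(1) by (auto simp: linear_pair_def)
    have "mvar j = subst l (l' j)" using l j by (simp add: linear_pair_def)
    also have "\<dots> = (\<Sum>i\<in>{0..n}. mconst (c i) * l i)"
      by (simp add: c subst_simps)
    also have "\<dots> \<in> P"
    proof -
      have "(\<Sum>i\<in>S. mconst (c i) * l i) \<in> P" if "finite S" "S \<subseteq> {0..n}" for S
        using that by (induction S) (auto intro!: add mult lP polys_in_mconst zero)
      then show ?thesis by blast
    qed
    finally show False using j by blast
  qed
  then show "\<exists>f\<in>rat_of n l. \<exists>i\<le>n. f i \<notin> P"
    using rat_map_self[OF linear_pair_forms[OF l]] by (intro bexI[of _ l]) (simp_all add: rat_of_def)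
qed

lemma linear_in_Aut_P:
  assumes l: "linear_pair n l l'"
  shows "rat_of n l \<in> Aut_P n"
  unfolding Aut_P_def
proof (intro CollectI conjI)
  show "everywhere_defined n (inv\<^bsub>Bir n\<^esub> rat_of n l)"
    unfolding linear_inv_Bir[OF l] by (rule linear_everywhere_defined[OF linear_pair_sym[OF l]])
qed (rule linear_in_Bir[OF l] linear_everywhere_defined[OF l])+

section \<open>Points of projective space in the orbit of the generic point\<close>

text \<open>Here \<open>\<phi>\<close> is a point with coordinates in the function field, and its
  rational map is the one sending the generic point to it. Nonemptiness guarantees a representing
  tuple of forms.\<close>

definition orbit :: "nat \<Rightarrow> (nat \<Rightarrow> 'k::field mpoly fract) \<Rightarrow> bool" where
  "orbit n \<phi> \<longleftrightarrow> rat_map n \<phi> \<in> G_group n \<and> rat_map n \<phi> \<noteq> {}"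

lemma orbit_proportional: "orbit n \<phi> \<Longrightarrow> proportional n \<psi> \<phi> \<Longrightarrow> orbit n \<psi>"
  unfolding orbit_def by (simp add: rat_map_eqI)

lemma orbitE:
  assumes "orbit n \<phi>"
  obtains g where "g \<in> forms n" "proportional n (\<lambda>i. to_frac (g i)) \<phi>" "rat_of n g \<in> G_group n"
proof -
  from assms obtain g where "g \<in> rat_map n \<phi>" by (auto simp: orbit_def)
  from rat_map_memD[OF this] that[of g] assms show ?thesis by (simp add: orbit_def rat_of_def)
qed

lemma orbitI: "g \<in> forms n \<Longrightarrow> proportional n \<phi> (\<lambda>i. to_frac (g i)) \<Longrightarrow> rat_of n g \<in> G_group n \<Longrightarrow> orbit n \<phi>"
  using rat_map_eqI[of n \<phi>] rat_map_self[of g n] by (auto simp: orbit_def rat_of_def)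

lemma orbit_nonzero: "orbit n \<phi> \<Longrightarrow> \<exists>i\<le>n. \<phi> i \<noteq> 0"
  by (erule orbitE) (rule proportionalD(2))

lemma orbit_cong: "orbit n \<phi> \<Longrightarrow> (\<And>i. i \<le> n \<Longrightarrow> \<psi> i = \<phi> i) \<Longrightarrow> orbit n \<psi>"
  by (rule orbit_proportional, assumption, rule proportional_scale[of 1]) (auto dest: orbit_nonzero)

lemma orbit_generic: "orbit n (\<lambda>i. to_frac (mvar i))"
proof (rule orbitI)
  have "\<one>\<^bsub>Bir n\<^esub> \<in> G_group n" unfolding G_group_def by (rule generate.one)
  then show "rat_of n mvar \<in> G_group n" by (simp add: Bir_def rat_id_def rat_of_def)
qed (auto simp: mvar_forms intro!: proportional_refl)

abbreviation const_frac :: "'k::field \<Rightarrow> 'k mpoly fract" where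
  "const_frac c \<equiv> to_frac (mconst c)"

text \<open>Composition from the left acts on points by evaluation: with a representative
  \<open>g\<close> of the point, \<open>subst g (f i)\<close> is the value of \<open>f i\<close> up
  to a common factor.\<close>

lemma orbit_form:
  assumes f: "f \<in> forms n" "rat_of n f \<in> G_group n" and \<phi>: "orbit n \<phi>"
    and nz: "\<exists>i\<le>n. insertion const_frac \<phi> (f i) \<noteq> 0"
  shows "orbit n (\<lambda>i. insertion const_frac \<phi> (f i))"
proof -
  from \<phi> obtain g where g: "g \<in> forms n" "proportional n (\<lambda>i. to_frac (g i)) \<phi>" "rat_of n g \<in> G_group n"
    by (rule orbitE)
  have p: "proportional n (\<lambda>i. to_frac (subst g (f i))) (\<lambda>i. insertion const_frac \<phi> (f i))"
    unfolding to_frac_subst by (rule insertion_proportional[OF f(1) g(2) ring_map_const_frac nz])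
  then have nz': "\<exists>i\<le>n. subst g (f i) \<noteq> 0"
    using proportionalD(1) by fastforce
  have "rat_of n f \<otimes>\<^bsub>Bir n\<^esub> rat_of n g \<in> G_group n"
    using f(2) g(3) unfolding G_group_def by (rule generate.eng)
  then have "rat_of n (\<lambda>i. subst g (f i)) \<in> G_group n"
    using rat_comp_eq[OF f(1) g(1) nz'] by (simp add: Bir_def rat_of_def)
  then show ?thesis
    by (intro orbitI[OF forms_subst[OF f(1) g(1) nz']] proportional_sym[OF p])
qed

lemma orbit_linear:
  assumes l: "linear_pair n l l'" and \<phi>: "orbit n \<phi>"
  shows "orbit n (\<lambda>i. insertion const_frac \<phi> (l i))"
proof (rule orbit_form[OF linear_pair_forms[OF l] _ \<phi>])
  show "rat_of n l \<in> G_group n"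
    unfolding G_group_def using linear_in_Aut_P[OF l] by (intro generate.incl) simp
  show "\<exists>i\<le>n. insertion const_frac \<phi> (l i) \<noteq> 0"
    by (rule linear_pair_nonzero[OF l ring_map_const_frac orbit_nonzero[OF \<phi>]])
qed

lemma orbit_inverse:
  assumes \<phi>: "orbit n \<phi>" and nz: "\<And>i. i \<le> n \<Longrightarrow> \<phi> i \<noteq> 0"
  shows "orbit n (\<lambda>i. 1 / \<phi> i)"
proof -
  \<comment> \<open>The standard involution with denominators cleared: \<open>1 / x_i\<close> times
    the product of all coordinates, a form of degree \<open>n\<close>.\<close>
  define s :: "nat \<Rightarrow> 'a mpoly" where "s i = (\<Prod>j\<in>{0..n} - {i}. mvar j)" for i
  have pr: "proportional n (\<lambda>i. insertion const_frac \<psi> (s i)) (\<lambda>i. 1 / \<psi> i)"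
    if nz: "\<And>i. i \<le> n \<Longrightarrow> \<psi> i \<noteq> 0" for \<psi> :: "nat \<Rightarrow> 'a mpoly fract"
  proof (rule proportional_scale)
    show "(\<Prod>j\<in>{0..n}. \<psi> j) \<noteq> 0" using nz by auto
    show "\<exists>i\<le>n. 1 / \<psi> i \<noteq> 0" using nz[of 0] by (intro exI[of _ 0]) auto
    fix i assume "i \<le> n"
    then have "(\<Prod>j\<in>{0..n}. \<psi> j) = \<psi> i * (\<Prod>j\<in>{0..n} - {i}. \<psi> j)"
      by (simp add: prod.remove)
    then show "insertion const_frac \<psi> (s i) = (\<Prod>j\<in>{0..n}. \<psi> j) * (1 / \<psi> i)"
      using nz[OF \<open>i \<le> n\<close>]
      by (simp add: s_def insertion_simps[OF ring_map_const_frac] insertion_mvar[OF ring_map_const_frac])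
  qed
  have s_nz: "s i \<noteq> 0" for i by (simp add: s_def)
  have s: "s \<in> forms n"
  proof -
    have "s i \<in> polys_in {0..n}" for i unfolding s_def by (intro polys_in_prod polys_in_mvar) auto
    moreover have "homogeneous n (s i)" if i: "i \<le> n" for i
    proof -
      have "homogeneous (\<Sum>j\<in>{0..n} - {i}. Suc 0) (s i)"
        unfolding s_def by (intro homogeneous_prod homogeneous_mvar)
      then show ?thesis using i by simp
    qed
    ultimately show ?thesis using s_nz by (auto simp: forms_def)
  qed
  have "proportional n (\<lambda>i. to_frac (s i)) (\<lambda>i. 1 / to_frac (mvar i))"
    using pr[of "\<lambda>i. to_frac (mvar i)"] by (simp flip: to_frac_subst)
  then have "rat_of n s = std_involution n"
    unfolding rat_of_def std_involution_def by (rule rat_map_eqI)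
  then have G: "rat_of n s \<in> G_group n"
    unfolding G_group_def by (intro generate.incl) simp
  have p: "proportional n (\<lambda>i. insertion const_frac \<phi> (s i)) (\<lambda>i. 1 / \<phi> i)"
    by (rule pr) (rule nz)
  have "\<exists>i\<le>n. insertion const_frac \<phi> (s i) \<noteq> 0"
    by (rule proportionalD(1)[OF p])
  from orbit_proportional[OF orbit_form[OF s G \<phi> this] proportional_sym[OF p]]
  show ?thesis .
qed

lemmas const_frac_insertion_simps =
  insertion_simps[OF ring_map_const_frac] insertion_mconst[OF ring_map_const_frac]
  insertion_mvar[OF ring_map_const_frac]

lemmas const_frac_simps = ring_map_simps[OF ring_map_const_frac]

section \<open>Words in the standard involution and linear maps\<close>

lemma orbit_shear:
  assumes "orbit n \<phi>" "r \<le> n" "s \<le> n" "r \<noteq> s"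
  shows "orbit n (\<phi>(r := \<phi> r + const_frac c * \<phi> s))"
proof -
  define l where "l c = mvar(r := mvar r + mconst c * mvar s)" for c :: 'a
  have 1: "l c i \<in> polys_in {0..n} \<and> homogeneous 1 (l c i) \<and> subst (l c) (l (- c) i) = mvar i"
    if "i \<le> n" for i c
    using that assms(2-4)
    by (auto simp: l_def subst_simps mconst_simps
        intro!: polys_in_intros homogeneous_mvar homogeneous_add homogeneous_mconst_mult)
  have "linear_pair n (l c) (l (- c))"
    using 1[of _ c] 1[of _ "- c"] by (simp add: linear_pair_def)
  from orbit_linear[OF this assms(1)] show ?thesis
    by (rule orbit_cong) (simp add: l_def const_frac_insertion_simps)
qed

lemma orbit_scale_coordinate:
  assumes "orbit n \<phi>" "r \<le> n" "c \<noteq> 0"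
  shows "orbit n (\<phi>(r := const_frac c * \<phi> r))"
proof -
  define l where "l c = mvar(r := mconst c * mvar r)" for c :: 'a
  have 1: "l c i \<in> polys_in {0..n} \<and> homogeneous 1 (l c i) \<and> subst (l c) (l c' i) = mvar i"
    if "i \<le> n" "c * c' = 1" for i c c'
  proof -
    have "mconst c' * (mconst c * mvar r) = mconst (c * c') * mvar r"
      by (simp add: mconst_simps mult_ac)
    then show ?thesis
      using that assms(2)
      by (auto simp: l_def subst_simps mconst_simps
          intro!: polys_in_intros homogeneous_mvar homogeneous_mconst_mult)
  qed
  have "linear_pair n (l c) (l (1 / c))"
    using 1[of _ c "1 / c"] 1[of _ "1 / c" c] assms(3) by (simp add: linear_pair_def)
  from orbit_linear[OF this assms(1)] show ?thesis
    by (rule orbit_cong) (simp add: l_def const_frac_insertion_simps)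
qed

lemma orbit_swap:
  assumes "orbit n \<phi>" "r \<le> n" "s \<le> n"
  shows "orbit n (\<phi>(r := \<phi> s, s := \<phi> r))"
proof -
  define l :: "nat \<Rightarrow> 'a mpoly" where "l = mvar(r := mvar s, s := mvar r)"
  have "linear_pair n l l"
    using assms(2,3) by (auto simp: linear_pair_def l_def intro!: polys_in_mvar homogeneous_mvar)
  from orbit_linear[OF this assms(1)] show ?thesis
    by (rule orbit_cong) (simp add: l_def const_frac_insertion_simps)
qed

lemma orbit_invert_coordinate:
  assumes \<phi>: "orbit n \<phi>" and \<phi>0: "\<phi> 0 = 1" and r: "1 \<le> r" "r \<le> n"
    and nz: "\<And>j. j \<le> n \<Longrightarrow> \<phi> j \<noteq> 0" and ne1: "\<phi> r \<noteq> 1"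
  shows "orbit n (\<phi>(r := 1 / \<phi> r))"
proof -
  \<comment> \<open>The matrix of \<open>z \<mapsto> - 1 / z\<close> is a product of unipotent matrices, and \<open>\<sigma>\<close> conjugates
    the translation \<open>z \<mapsto> z + 1\<close> into the opposite unipotent map \<open>z \<mapsto> z / (z + 1)\<close>.\<close>
  have "orbit n (\<phi>(r := \<phi> r - 1))" (is "orbit n ?\<phi>1")
    using orbit_shear[OF \<phi> r(2) _ , of 0 "- 1"] r \<phi>0 by (simp add: const_frac_simps)
  then have "orbit n (\<lambda>j. 1 / ?\<phi>1 j)"
    by (rule orbit_inverse) (use nz ne1 in auto)
  then have "orbit n ((\<lambda>j. 1 / ?\<phi>1 j)(r := 1 / (\<phi> r - 1) + const_frac 1 * (1 / ?\<phi>1 0)))" (is "orbit n ?\<phi>2")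
    using orbit_shear[of n "\<lambda>j. 1 / ?\<phi>1 j" r 0 1] r by simp
  \<comment> \<open>At the index \<open>r\<close> this point has the coordinate
    \<open>\<phi> r / (\<phi> r - 1)\<close>.\<close>
  moreover have \<phi>2: "?\<phi>2 j \<noteq> 0" if "j \<le> n" for j
    using nz[OF that] ne1 r \<phi>0 that by (auto simp: const_frac_simps field_simps)
  ultimately have "orbit n (\<lambda>j. 1 / ?\<phi>2 j)"
    by (rule orbit_inverse)
  \<comment> \<open>The second inversion restores the other coordinates and produces
    \<open>1 - 1 / \<phi> r\<close>; a translation by -1 and a change of sign remain.\<close>
  then have "orbit n (\<phi>(r := 1 - 1 / \<phi> r))"
    by (rule orbit_cong) (use nz[OF r(2)] ne1 r \<phi>0 in \<open>auto simp: const_frac_simps field_simps\<close>)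
  then have "orbit n (\<phi>(r := - 1 / \<phi> r))"
    using orbit_shear[of n "\<phi>(r := 1 - 1 / \<phi> r)" r 0 "- 1"] r \<phi>0 by (simp add: const_frac_simps)
  then show ?thesis
    using orbit_scale_coordinate[of n "\<phi>(r := - 1 / \<phi> r)" r "- 1"] r by (simp add: const_frac_simps)
qed

text \<open>This is the map \<open>S\<close>. Exchanging the coordinates 0 and \<open>r\<close> and
  normalising the zeroth one to 1 divides the rest by \<open>\<phi> r\<close>, but leaves
  \<open>1 / \<phi> r\<close> at \<open>r\<close>, which is then inverted back.\<close>

lemma orbit_divide_others:
  assumes \<phi>: "orbit n \<phi>" and \<phi>0: "\<phi> 0 = 1" and r: "1 \<le> r" "r \<le> n"
    and nz: "\<And>j. j \<le> n \<Longrightarrow> \<phi> j \<noteq> 0" and ne1: "\<phi> r \<noteq> 1"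
  shows "orbit n (\<lambda>j. if j \<in> {0, r} then \<phi> j else \<phi> j / \<phi> r)"
proof -
  have "orbit n (\<phi>(0 := \<phi> r, r := \<phi> 0))"
    by (rule orbit_swap[OF \<phi>]) (use r in auto)
  then have "orbit n (\<lambda>j. if j = 0 then 1 else if j = r then 1 / \<phi> r else \<phi> j / \<phi> r)" (is "orbit n ?\<psi>")
    by (rule orbit_proportional, intro proportional_scale[of "1 / \<phi> r"])
      (use r nz \<phi>0 in \<open>auto intro!: exI[of _ 0]\<close>)
  then have "orbit n (?\<psi>(r := 1 / ?\<psi> r))"
    by (rule orbit_invert_coordinate) (use r nz ne1 in auto)
  then show ?thesis
    by (rule orbit_cong) (use r \<phi>0 in auto)
qed

text \<open>This is the map \<open>J\<close>: the standard involution inverts everything, and the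
  inversion is undone at the indices 1 and \<open>r\<close>.\<close>

lemma orbit_invert_others:
  assumes \<phi>: "orbit n \<phi>" and \<phi>0: "\<phi> 0 = 1" and r: "2 \<le> r" "r \<le> n"
    and nz: "\<And>j. j \<le> n \<Longrightarrow> \<phi> j \<noteq> 0" and ne1: "\<phi> 1 \<noteq> 1" "\<phi> r \<noteq> 1"
  shows "orbit n (\<lambda>j. if j \<in> {0, 1, r} then \<phi> j else 1 / \<phi> j)"
proof -
  define \<psi> where "\<psi> j = 1 / \<phi> j" for j
  have "orbit n \<psi>"
    unfolding \<psi>_def by (rule orbit_inverse[OF \<phi> nz])
  then have "orbit n (\<psi>(1 := 1 / \<psi> 1))" (is "orbit n ?\<psi>1")
    by (rule orbit_invert_coordinate) (use r nz[of 1] nz ne1 \<phi>0 in \<open>auto simp: \<psi>_def\<close>)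
  then have "orbit n (?\<psi>1(r := 1 / ?\<psi>1 r))"
    by (rule orbit_invert_coordinate) (use r nz[of 1] nz ne1 \<phi>0 in \<open>auto simp: \<psi>_def\<close>)
  then show ?thesis
    by (rule orbit_cong) (use r \<phi>0 in \<open>auto simp: \<psi>_def\<close>)
qed

lemma orbit_divide_square:
  assumes \<phi>: "orbit n \<phi>" and \<phi>0: "\<phi> 0 = 1" and r: "2 \<le> r" "r \<le> n"
    and nz: "\<And>j. j \<le> n \<Longrightarrow> \<phi> j \<noteq> 0" and ne: "\<phi> r \<noteq> 1" "\<phi> 1 \<noteq> \<phi> r" "\<phi> 1 \<noteq> (\<phi> r)\<^sup>2"
  shows "orbit n (\<phi>(1 := \<phi> 1 / (\<phi> r)\<^sup>2))"
proof -
  have r1: "1 \<le> r" using r by simp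
  \<comment> \<open>Along the word \<open>J S J S\<close>, the first coordinate runs through
    \<open>x_1/x_r\<close>, \<open>x_1/x_r\<close>, \<open>x_1/x_r^2\<close>,
    \<open>x_1/x_r^2\<close>, and an \<open>x_j\<close> outside 0, 1, \<open>r\<close> through
    \<open>x_j/x_r\<close>, \<open>x_r/x_j\<close>, \<open>1/x_j\<close>, \<open>x_j\<close>. The
    conditions on \<open>\<phi> 1\<close> keep the first coordinate away from 1 whenever
    \<open>J\<close> is applied.\<close>
  define \<phi>1 where "\<phi>1 j = (if j \<in> {0, r} then \<phi> j else \<phi> j / \<phi> r)" for j
  define \<phi>2 where "\<phi>2 j = (if j \<in> {0, 1, r} then \<phi>1 j else 1 / \<phi>1 j)" for j
  define \<phi>3 where "\<phi>3 j = (if j \<in> {0, r} then \<phi>2 j else \<phi>2 j / \<phi>2 r)" for j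
  define \<phi>4 where "\<phi>4 j = (if j \<in> {0, 1, r} then \<phi>3 j else 1 / \<phi>3 j)" for j
  note defs = \<phi>1_def \<phi>2_def \<phi>3_def \<phi>4_def
  have nzr: "\<phi> r \<noteq> 0" by (rule nz[OF r(2)])
  have "orbit n \<phi>1"
    unfolding \<phi>1_def by (rule orbit_divide_others[OF \<phi> \<phi>0 r1 r(2) nz ne(1)])
  then have "orbit n \<phi>2"
    unfolding \<phi>2_def
    by (rule orbit_invert_others) (use r nz nzr ne \<phi>0 in \<open>auto simp: \<phi>1_def\<close>)
  then have "orbit n \<phi>3"
    unfolding \<phi>3_def
    by (rule orbit_divide_others) (use r nz nzr ne \<phi>0 in \<open>auto simp: \<phi>1_def \<phi>2_def\<close>)
  then have "orbit n \<phi>4"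
    unfolding \<phi>4_def
    by (rule orbit_invert_others)
      (use r nz nzr ne \<phi>0 in \<open>auto simp: \<phi>1_def \<phi>2_def \<phi>3_def power2_eq_square field_simps\<close>)
  then show ?thesis
    by (rule orbit_cong) (use r \<phi>0 nzr in \<open>auto simp: defs power2_eq_square\<close>)
qed

text \<open>Inverting the first coordinate before and after turns division by the square into
  multiplication. The inequations are those of the three steps, rewritten in terms of the original
  point.\<close>

lemma orbit_mult_square:
  assumes \<phi>: "orbit n \<phi>" and \<phi>0: "\<phi> 0 = 1" and r: "2 \<le> r" "r \<le> n"
    and nz: "\<And>j. j \<le> n \<Longrightarrow> \<phi> j \<noteq> 0"
    and ne: "\<phi> r \<noteq> 1" "\<phi> 1 \<noteq> 1" "\<phi> 1 * \<phi> r \<noteq> 1" "\<phi> 1 * (\<phi> r)\<^sup>2 \<noteq> 1"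
  shows "orbit n (\<phi>(1 := \<phi> 1 * (\<phi> r)\<^sup>2))"
proof -
  have r1: "(1::nat) \<le> n" using r by simp
  note nz1 = nz[OF r1] nz[OF r(2)]
  have "orbit n (\<phi>(1 := 1 / \<phi> 1))" (is "orbit n ?\<phi>1")
    by (rule orbit_invert_coordinate[OF \<phi> \<phi>0]) (use r nz ne in auto)
  then have "orbit n (?\<phi>1(1 := ?\<phi>1 1 / (?\<phi>1 r)\<^sup>2))" (is "orbit n ?\<phi>2")
    by (rule orbit_divide_square) (use r nz nz1 ne \<phi>0 in \<open>auto simp: field_simps\<close>)
  then have "orbit n (?\<phi>2(1 := 1 / ?\<phi>2 1))"
    by (rule orbit_invert_coordinate) (use r nz nz1 ne \<phi>0 in \<open>auto simp: field_simps\<close>)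
  then show ?thesis
    by (rule orbit_cong) (use r in \<open>auto simp: field_simps\<close>)
qed

section \<open>Elementary maps\<close>

text \<open>A subfield of the function field containing the constants. A first coordinate
  \<open>z\<close> outside of \<open>E\<close> automatically avoids the exceptional values of the
  words above, and it stays outside under addition of elements of \<open>E\<close> and scaling by
  nonzero ones.\<close>

locale coefficient_field =
  fixes E :: "'k::field mpoly fract set"
  assumes const_in: "const_frac c \<in> E"
    and add_in: "x \<in> E \<Longrightarrow> y \<in> E \<Longrightarrow> x + y \<in> E"
    and mult_in: "x \<in> E \<Longrightarrow> y \<in> E \<Longrightarrow> x * y \<in> E"
    and inverse_in: "x \<in> E \<Longrightarrow> inverse x \<in> E"
begin

lemma divide_in: "x \<in> E \<Longrightarrow> y \<in> E \<Longrightarrow> x / y \<in> E"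
  by (simp add: divide_inverse mult_in inverse_in)

lemma diff_in: "x \<in> E \<Longrightarrow> y \<in> E \<Longrightarrow> x - y \<in> E"
  using add_in[OF _ mult_in[OF const_in[of "- 1"]], of x y] by (simp add: const_frac_simps)

lemma zero_in: "0 \<in> E" and one_in: "1 \<in> E"
  using const_in[of 0] const_in[of 1] by (simp_all add: const_frac_simps)

lemma power_in: "x \<in> E \<Longrightarrow> x ^ m \<in> E"
  by (induction m) (auto intro: one_in mult_in)

lemma mult_notin: "z \<notin> E \<Longrightarrow> e \<in> E \<Longrightarrow> e \<noteq> 0 \<Longrightarrow> z * e \<notin> E"
  using divide_in[of "z * e" e] by auto

lemma divide_notin: "z \<notin> E \<Longrightarrow> e \<in> E \<Longrightarrow> e \<noteq> 0 \<Longrightarrow> z / e \<notin> E"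
  using mult_in[of "z / e" e] by auto

lemma add_notin: "z \<notin> E \<Longrightarrow> e \<in> E \<Longrightarrow> z + e \<notin> E"
  using diff_in[of "z + e" e] by auto

end

text \<open>Conditions are put only on the coordinates from 2 on, because the first one will be
  overwritten by elements \<open>z\<close> outside of \<open>E\<close>. Being nonconstant keeps all
  translates of these coordinates away from 0 and 1.\<close>

locale generic_coordinates = coefficient_field E for E :: "'k::field mpoly fract set" +
  fixes n :: nat and \<phi> :: "nat \<Rightarrow> 'k mpoly fract"
  assumes two: "2 \<le> n"
    and zeroth: "\<phi> 0 = 1"
    and coord_in: "2 \<le> j \<Longrightarrow> j \<le> n \<Longrightarrow> \<phi> j \<in> E"
    and coord_not_const: "2 \<le> j \<Longrightarrow> j \<le> n \<Longrightarrow> \<phi> j \<noteq> const_frac c"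
begin

lemma coord_nonzero: "2 \<le> j \<Longrightarrow> j \<le> n \<Longrightarrow> \<phi> j \<noteq> 0"
  using coord_not_const[of j 0] by (simp add: const_frac_simps)

lemma coord_add_const: "2 \<le> j \<Longrightarrow> j \<le> n \<Longrightarrow> \<phi> j + const_frac a \<noteq> const_frac c"
  using coord_not_const[of j "c - a"] by (auto simp: const_frac_simps eq_diff_eq)

section \<open>Multiplication and division by squares of translated coordinates\<close>

context
  fixes r and a :: 'k and z :: "'k mpoly fract"
  assumes r: "2 \<le> r" "r \<le> n" and z: "z \<notin> E" and o: "orbit n (\<phi>(1 := z))"
begin

definition "shifted = \<phi>(1 := z, r := \<phi> r + const_frac a)"

lemma orbit_shifted: "orbit n shifted"
  using orbit_shear[OF o r(2), of 0 a] r zeroth by (simp add: shifted_def)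

lemma shift_facts:
  shows "\<phi> r + const_frac a \<in> E" "\<phi> r + const_frac a \<noteq> 0" "\<phi> r + const_frac a \<noteq> 1"
  using coord_add_const[OF r, of a 0] coord_add_const[OF r, of a 1]
  by (auto simp: const_frac_simps intro!: add_in coord_in const_in r)

lemma shifted_facts:
  shows "shifted 0 = 1" "shifted (Suc 0) = z" "shifted r = \<phi> r + const_frac a"
    "j \<le> n \<Longrightarrow> shifted j \<noteq> 0"
proof -
  show "shifted j \<noteq> 0" if "j \<le> n" for j
    using that r shift_facts z zeroth coord_nonzero[of j] zero_in
    by (cases "j = 0 \<or> j = 1 \<or> j = r") (auto simp: shifted_def)
qed (use r zeroth in \<open>auto simp: shifted_def\<close>)

lemma unshift:
  assumes "orbit n (shifted(1 := y))"
  shows "orbit n (\<phi>(1 := y))"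
  using orbit_shear[OF assms r(2), of 0 "- a"] r zeroth
  by (auto simp: shifted_def const_frac_simps elim!: orbit_cong)

text \<open>Translate the coordinate \<open>r\<close> by \<open>a\<close>, multiply by its square,
  and translate back. The products with \<open>z\<close> lie outside of \<open>E\<close>, so they
  differ from 1.\<close>

lemma orbit_mult_square_shift: "orbit n (\<phi>(1 := z * (\<phi> r + const_frac a)\<^sup>2))"
proof -
  note u = shift_facts
  have "z * (\<phi> r + const_frac a) \<notin> E" "z * (\<phi> r + const_frac a)\<^sup>2 \<notin> E"
    using mult_notin[OF z u(1,2)] mult_notin[OF z power_in[OF u(1)]] u(2) by auto
  then have "z * (\<phi> r + const_frac a) \<noteq> 1" "z * (\<phi> r + const_frac a)\<^sup>2 \<noteq> 1" "z \<noteq> 1"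
    using one_in z by metis+
  then have "orbit n (shifted(1 := shifted 1 * (shifted r)\<^sup>2))"
    using u by (intro orbit_mult_square[OF orbit_shifted _ r]) (auto simp: shifted_facts)
  then show ?thesis
    by (intro unshift) (simp add: shifted_facts)
qed

text \<open>The same conjugation by a translation; the forbidden values of \<open>z\<close> are a
  translated coordinate and its square, both of which lie in \<open>E\<close>.\<close>

lemma orbit_divide_square_shift: "orbit n (\<phi>(1 := z / (\<phi> r + const_frac a)\<^sup>2))"
proof -
  note u = shift_facts
  have "z \<noteq> \<phi> r + const_frac a" "z \<noteq> (\<phi> r + const_frac a)\<^sup>2"
    using u(1) power_in[OF u(1)] z by metis+
  then have "orbit n (shifted(1 := shifted 1 / (shifted r)\<^sup>2))"
    using u by (intro orbit_divide_square[OF orbit_shifted _ r]) (auto simp: shifted_facts)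
  then show ?thesis
    by (intro unshift) (simp add: shifted_facts)
qed

end

text \<open>The quantification over all \<open>z\<close> outside of \<open>E\<close> makes
  conjugation possible: \<open>e\<close> can be added after \<open>z\<close> has been rescaled by an
  element of \<open>E\<close>.\<close>

definition addable :: "'k mpoly fract set" where
  "addable = {e \<in> E. \<forall>z. z \<notin> E \<longrightarrow> orbit n (\<phi>(1 := z)) \<longrightarrow> orbit n (\<phi>(1 := z + e))}"

lemma addableI:
  "e \<in> E \<Longrightarrow> (\<And>z. z \<notin> E \<Longrightarrow> orbit n (\<phi>(1 := z)) \<Longrightarrow> orbit n (\<phi>(1 := z + e))) \<Longrightarrow> e \<in> addable"
  by (simp add: addable_def)

lemma addableD:
  assumes "e \<in> addable"
  shows "e \<in> E" "z \<notin> E \<Longrightarrow> orbit n (\<phi>(1 := z)) \<Longrightarrow> orbit n (\<phi>(1 := z + e))"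
  using assms by (simp_all add: addable_def)

lemma addable_const: "const_frac c \<in> addable"
proof (rule addableI[OF const_in])
  fix z assume "orbit n (\<phi>(1 := z))"
  from orbit_shear[OF this, of 1 0 c] two zeroth show "orbit n (\<phi>(1 := z + const_frac c))"
    by simp
qed

lemma addable_add: "e \<in> addable \<Longrightarrow> e' \<in> addable \<Longrightarrow> e + e' \<in> addable"
proof (rule addableI)
  fix z assume e: "e \<in> addable" "e' \<in> addable" and z: "z \<notin> E" "orbit n (\<phi>(1 := z))"
  have "orbit n (\<phi>(1 := z + e + e'))"
    by (rule addableD(2)[OF e(2) add_notin[OF z(1) addableD(1)[OF e(1)]] addableD(2)[OF e(1) z]])
  then show "orbit n (\<phi>(1 := z + (e + e')))" by (simp add: add.assoc)
qed (auto intro: add_in dest: addableD)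

text \<open>Conjugation by a scaling of the first coordinate: \<open>z\<close> is divided by
  \<open>c\<close>, then \<open>e\<close> is added, then the result is multiplied by
  \<open>c\<close>.\<close>

lemma addable_const_mult:
  assumes e: "e \<in> addable"
  shows "const_frac c * e \<in> addable"
proof (cases "c = 0")
  case True
  then show ?thesis using addable_const[of 0] by (simp add: const_frac_simps)
next
  case False
  show ?thesis
  proof (rule addableI)
    fix z assume z: "z \<notin> E" "orbit n (\<phi>(1 := z))"
    have "orbit n (\<phi>(1 := const_frac (1 / c) * z))"
      using orbit_scale_coordinate[OF z(2), of 1 "1 / c"] two False by simp
    moreover have "const_frac (1 / c) * z \<notin> E"
      using mult_notin[OF z(1) const_in[of "1 / c"]] False by (simp add: mult.commute)
    ultimately have "orbit n (\<phi>(1 := const_frac (1 / c) * z + e))"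
      by (intro addableD[OF e])
    then have "orbit n (\<phi>(1 := const_frac c * (const_frac (1 / c) * z + e)))"
      using orbit_scale_coordinate[of n "\<phi>(1 := const_frac (1 / c) * z + e)" 1 c] two False by simp
    moreover have "const_frac c * const_frac (1 / c) = 1"
      using False by (simp add: const_frac_simps flip: ring_map_mult[OF ring_map_const_frac])
    ultimately show "orbit n (\<phi>(1 := z + const_frac c * e))"
      by (simp add: distrib_left flip: mult.assoc)
  qed (use addableD[OF e] const_in mult_in in blast)
qed

text \<open>Conjugation by multiplication with the square \<open>u\<close>: the first coordinate
  passes from \<open>z\<close> through \<open>z / u\<close> and \<open>z / u + e\<close> to
  \<open>z + u * e\<close>, and it remains outside of \<open>E\<close> throughout.\<close>

lemma addable_square_mult:
  assumes e: "e \<in> addable" and r: "2 \<le> r" "r \<le> n"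
  shows "(\<phi> r + const_frac a)\<^sup>2 * e \<in> addable"
proof (rule addableI)
  let ?u = "(\<phi> r + const_frac a)\<^sup>2"
  have u: "?u \<in> E" by (intro power_in add_in coord_in const_in r)
  then show "?u * e \<in> E" by (intro mult_in addableD[OF e])
  have u0: "?u \<noteq> 0" using coord_add_const[OF r, of a 0] by (simp add: const_frac_simps)
  fix z assume z: "z \<notin> E" "orbit n (\<phi>(1 := z))"
  have "orbit n (\<phi>(1 := z / ?u))" by (rule orbit_divide_square_shift[OF r z])
  with divide_notin[OF z(1) u u0] have "orbit n (\<phi>(1 := z / ?u + e))"
    by (rule addableD[OF e])
  with add_notin[OF divide_notin[OF z(1) u u0] addableD(1)[OF e]]
  have "orbit n (\<phi>(1 := (z / ?u + e) * ?u))"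
    by (rule orbit_mult_square_shift[OF r])
  moreover have "(z / ?u + e) * ?u = z + ?u * e"
    using u0 by (simp add: distrib_right del: power_eq_0_iff)
  ultimately show "orbit n (\<phi>(1 := z + ?u * e))" by simp
qed

text \<open>Squares yield the coordinate itself by \<open>2 x = (x + 1)^2 - x^2 - 1\<close>.
  Dividing by 2 is the point where the hypothesis on the characteristic enters.\<close>

lemma addable_coord_mult:
  assumes char: "(2 :: 'k) \<noteq> 0" and e: "e \<in> addable" and r: "2 \<le> r" "r \<le> n"
  shows "\<phi> r * e \<in> addable"
proof -
  have "(\<phi> r + const_frac 1)\<^sup>2 * e + const_frac (- 1) * ((\<phi> r + const_frac 0)\<^sup>2 * e)
      + const_frac (- 1) * e \<in> addable"
    by (intro addable_add addable_const_mult addable_square_mult e r)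
  also have "(\<phi> r + const_frac 1)\<^sup>2 * e + const_frac (- 1) * ((\<phi> r + const_frac 0)\<^sup>2 * e)
      + const_frac (- 1) * e = const_frac 2 * (\<phi> r * e)"
    using ring_map_add[OF ring_map_const_frac, of 1 "1::'k"]
    by (simp add: const_frac_simps power2_eq_square algebra_simps)
  finally have "const_frac (1 / 2) * (const_frac 2 * (\<phi> r * e)) \<in> addable"
    by (rule addable_const_mult)
  moreover have "const_frac (1 / 2 :: 'k) * const_frac 2 = 1"
    using char by (simp add: const_frac_simps flip: ring_map_mult[OF ring_map_const_frac])
  ultimately show ?thesis by (simp flip: mult.assoc)
qed

lemma addable_insertion:
  assumes char: "(2 :: 'k) \<noteq> 0" and p: "p \<in> polys_in {2..n}"
  shows "insertion const_frac \<phi> p \<in> addable"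
  using p
proof (induction p rule: polys_in_induct)
  case (mconst c)
  then show ?case by (simp add: const_frac_insertion_simps addable_const)
next
  case (mvar_mult i q)
  then show ?case by (simp add: const_frac_insertion_simps addable_coord_mult[OF char])
next
  case (add p q)
  then show ?case by (simp add: const_frac_insertion_simps addable_add)
qed

end

section \<open>Tame automorphisms\<close>

lemma aff_comp_apply: "i \<in> {1..n} \<Longrightarrow> aff_comp n f g i = subst g (f i)"
  by (simp add: aff_comp_def)

lemma aff_endosD: "f \<in> aff_endos n \<Longrightarrow> i \<in> {1..n} \<Longrightarrow> f i \<in> polys_in {1..n}"
  by (auto simp: aff_endos_def)

lemma aff_endos_ext:
  assumes "f \<in> aff_endos n" "g \<in> aff_endos n" "\<And>i. i \<in> {1..n} \<Longrightarrow> f i = g i"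
  shows "f = g"
  using assms unfolding aff_endos_def by (intro PiE_ext)

lemma aff_comp_closed: "f \<in> aff_endos n \<Longrightarrow> g \<in> aff_endos n \<Longrightarrow> aff_comp n f g \<in> aff_endos n"
  by (auto simp: aff_comp_def aff_endos_def intro!: polys_in_subst[of _ "{1..n}"])

lemma aff_id_closed: "aff_id n \<in> aff_endos n"
  by (auto simp: aff_id_def aff_endos_def intro!: polys_in_mvar)

lemma aff_comp_assoc:
  assumes "f \<in> aff_endos n" "g \<in> aff_endos n" "h \<in> aff_endos n"
  shows "aff_comp n (aff_comp n f g) h = aff_comp n f (aff_comp n g h)"
proof (rule aff_endos_ext[of _ n])
  fix i assume i: "i \<in> {1..n}"
  show "aff_comp n (aff_comp n f g) h i = aff_comp n f (aff_comp n g h) i"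
    using i by (simp add: aff_comp_apply subst_subst)
      (rule subst_cong[OF aff_endosD[OF assms(1) i]], simp add: aff_comp_apply)
qed (intro aff_comp_closed assms)+

lemma aff_comp_id_left: "f \<in> aff_endos n \<Longrightarrow> aff_comp n (aff_id n) f = f"
  by (rule aff_endos_ext[of _ n])
    (assumption | intro aff_comp_closed aff_id_closed | simp add: aff_comp_apply, simp add: aff_id_def)+

text \<open>The group laws serve to identify the inverses of the generators of the tame group, which
  \<open>generate\<close> also contains.\<close>

lemma group_Aut_A: "group (Aut_A n :: (nat \<Rightarrow> 'a::field mpoly) monoid)"
proof (rule groupI)
  fix f g :: "nat \<Rightarrow> 'a mpoly" assume "f \<in> carrier (Aut_A n)" "g \<in> carrier (Aut_A n)"
  then obtain f' g' where f: "f \<in> aff_endos n" "f' \<in> aff_endos n"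
      "aff_comp n f f' = aff_id n" "aff_comp n f' f = aff_id n"
    and g: "g \<in> aff_endos n" "g' \<in> aff_endos n"
      "aff_comp n g g' = aff_id n" "aff_comp n g' g = aff_id n"
    by (auto simp: Aut_A_def)
  have cancel: "aff_comp n (aff_comp n a b) (aff_comp n b' a') = aff_id n"
    if "a \<in> aff_endos n" "b \<in> aff_endos n" "a' \<in> aff_endos n" "b' \<in> aff_endos n"
      "aff_comp n a a' = aff_id n" "aff_comp n b b' = aff_id n" for a b a' b'
  proof -
    have "aff_comp n (aff_comp n a b) (aff_comp n b' a')
        = aff_comp n a (aff_comp n (aff_comp n b b') a')"
      using that(1-4) by (simp add: aff_comp_assoc aff_comp_closed)
    then show ?thesis using that by (simp add: aff_comp_id_left)
  qed
  have "aff_comp n (aff_comp n f g) (aff_comp n g' f') = aff_id n"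
    "aff_comp n (aff_comp n g' f') (aff_comp n f g) = aff_id n"
    by (rule cancel; fact)+
  then show "f \<otimes>\<^bsub>Aut_A n\<^esub> g \<in> carrier (Aut_A n)"
    using f g by (auto simp: Aut_A_def intro!: aff_comp_closed bexI[of _ "aff_comp n g' f'"])
next
  show "\<one>\<^bsub>Aut_A n\<^esub> \<in> carrier (Aut_A n)"
    using aff_id_closed aff_comp_id_left[OF aff_id_closed] by (auto simp: Aut_A_def)
qed (auto simp: Aut_A_def aff_comp_assoc aff_comp_id_left)

lemma Aut_A_inverse:
  assumes "f \<in> aff_endos n" "g \<in> aff_endos n" "aff_comp n f g = aff_id n" "aff_comp n g f = aff_id n"
  shows "f \<in> carrier (Aut_A n)" "inv\<^bsub>Aut_A n\<^esub> f = g"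
proof -
  show "f \<in> carrier (Aut_A n)" using assms by (auto simp: Aut_A_def)
  moreover have "g \<in> carrier (Aut_A n)" using assms by (auto simp: Aut_A_def)
  ultimately show "inv\<^bsub>Aut_A n\<^esub> f = g"
    using assms by (intro group.inv_equality[OF group_Aut_A]) (simp_all add: Aut_A_def)
qed

section \<open>Action of affine automorphisms on points with zeroth coordinate 1\<close>

definition affine_image ::
  "(nat \<Rightarrow> 'k::field mpoly) \<Rightarrow> (nat \<Rightarrow> 'k mpoly fract) \<Rightarrow> nat \<Rightarrow> 'k mpoly fract" where
  "affine_image f \<phi> = (\<lambda>i. if i = 0 then 1 else insertion const_frac \<phi> (f i))"

text \<open>The affine coordinates of such a point are algebraically independent over the ground
  field.\<close>

definition free_point :: "nat \<Rightarrow> (nat \<Rightarrow> 'k::field mpoly fract) \<Rightarrow> bool" where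
  "free_point n \<phi> \<longleftrightarrow> \<phi> 0 = 1 \<and> (\<forall>p\<in>polys_in {1..n}. insertion const_frac \<phi> p = 0 \<longrightarrow> p = 0)"

lemma insertion_affine_image:
  assumes "p \<in> polys_in {1..n}"
  shows "insertion const_frac (affine_image f \<phi>) p = insertion const_frac \<phi> (subst f p)"
  unfolding insertion_subst[OF ring_map_const_frac]
  by (rule insertion_cong[OF assms]) (simp add: affine_image_def)

text \<open>A relation between the new coordinates becomes, after substituting \<open>f\<close>, one
  between the old ones. So \<open>subst f p\<close> is zero, and substituting the inverse of
  \<open>f\<close> returns \<open>p\<close>.\<close>

lemma free_affine_image:
  assumes "f \<in> carrier (Aut_A n)" "free_point n \<phi>"
  shows "free_point n (affine_image f \<phi>)"
proof -
  obtain g where f: "f \<in> aff_endos n" and g: "aff_comp n f g = aff_id n" "aff_comp n g f = aff_id n"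
    using assms(1) by (auto simp: Aut_A_def)
  have "p = 0" if p: "p \<in> polys_in {1..n}" and z: "insertion const_frac \<phi> (subst f p) = 0" for p
  proof -
    have "subst f p \<in> polys_in {1..n}"
      by (rule polys_in_subst[OF p aff_endosD[OF f]])
    with z assms(2) have "subst f p = 0" by (simp add: free_point_def)
    then have "0 = subst g (subst f p)" by (simp add: subst_simps)
    also have "\<dots> = subst mvar p"
      unfolding subst_subst
    proof (rule subst_cong[OF p])
      fix i assume "i \<in> {1..n}"
      then show "subst g (f i) = mvar i"
        using fun_cong[OF g(1), of i] by (simp add: aff_comp_def aff_id_def)
    qed
    finally show "p = 0" by simp
  qed
  then show ?thesis
    by (simp add: free_point_def insertion_affine_image) (simp add: affine_image_def)
qed

text \<open>The restriction to free points excludes the points where the words for elementary maps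
  break down, and it is compatible with composition because automorphisms keep points free.\<close>

definition preserves_orbit :: "nat \<Rightarrow> (nat \<Rightarrow> 'k::field mpoly) \<Rightarrow> bool" where
  "preserves_orbit n f \<longleftrightarrow> (\<forall>\<phi>. free_point n \<phi> \<longrightarrow> orbit n \<phi> \<longrightarrow> orbit n (affine_image f \<phi>))"

lemma preserves_orbit_id: "preserves_orbit n (aff_id n)"
  unfolding preserves_orbit_def free_point_def
  by (auto elim!: orbit_cong simp: affine_image_def aff_id_def const_frac_insertion_simps)

lemma preserves_orbit_comp:
  fixes f :: "nat \<Rightarrow> 'a::field mpoly"
  assumes f: "f \<in> carrier (Aut_A n)" "preserves_orbit n f"
    and g: "g \<in> carrier (Aut_A n)" "preserves_orbit n g"
  shows "preserves_orbit n (aff_comp n f g)"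
  unfolding preserves_orbit_def
proof (intro allI impI)
  fix \<phi> :: "nat \<Rightarrow> 'a mpoly fract" assume \<phi>: "free_point n \<phi>" "orbit n \<phi>"
  have "orbit n (affine_image f (affine_image g \<phi>))"
    using f(2) g(2) \<phi> free_affine_image[OF g(1)] by (simp add: preserves_orbit_def)
  then show "orbit n (affine_image (aff_comp n f g) \<phi>)"
  proof (rule orbit_cong)
    fix i assume i: "i \<le> n"
    have "f \<in> aff_endos n" using f(1) by (simp add: Aut_A_def)
    then show "affine_image (aff_comp n f g) \<phi> i = affine_image f (affine_image g \<phi>) i"
      using i insertion_affine_image[OF aff_endosD[of f n i], of g \<phi>]
      by (simp add: affine_image_def aff_comp_def)
  qed
qed

section \<open>Linear automorphisms\<close>

definition linear_forms :: "nat set \<Rightarrow> (nat \<Rightarrow> nat \<Rightarrow> 'k::field) \<Rightarrow> nat \<Rightarrow> 'k mpoly" where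
  "linear_forms V A i = (\<Sum>j\<in>V. mconst (A i j) * mvar j)"

lemma linear_forms_in: "linear_forms V A i \<in> polys_in V"
  unfolding linear_forms_def by (intro polys_in_intros)

lemma linear_forms_homogeneous: "homogeneous 1 (linear_forms V A i)"
  using homogeneous_mvar by (auto simp: linear_forms_def intro!: homogeneous_sum homogeneous_mconst_mult)

lemma linear_forms_inverse:
  assumes V: "finite V" "i \<in> V" and g: "\<And>j. j \<in> V \<Longrightarrow> g j = linear_forms V B j"
    and AB: "\<And>k. k \<in> V \<Longrightarrow> (\<Sum>j\<in>V. A i j * B j k) = (if i = k then 1 else 0)"
  shows "subst g (linear_forms V A i) = mvar i"
proof -
  have "subst g (linear_forms V A i) = (\<Sum>j\<in>V. mconst (A i j) * linear_forms V B j)"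
    by (simp add: linear_forms_def[of V A] subst_simps g)
  also have "\<dots> = (\<Sum>j\<in>V. \<Sum>k\<in>V. mconst (A i j * B j k) * mvar k)"
    by (simp add: linear_forms_def sum_distrib_left mconst_simps mult.assoc)
  also have "\<dots> = (\<Sum>k\<in>V. \<Sum>j\<in>V. mconst (A i j * B j k) * mvar k)"
    by (rule sum.swap)
  also have "\<dots> = (\<Sum>k\<in>V. mconst (\<Sum>j\<in>V. A i j * B j k) * mvar k)"
    by (simp only: mconst_simps(7) sum_distrib_right)
  also have "\<dots> = (\<Sum>k\<in>V. if k = i then mvar k else 0)"
    by (intro sum.cong) (auto simp: AB mconst_simps)
  also have "\<dots> = mvar i" using V by simp
  finally show ?thesis .
qed

definition linear_map :: "nat \<Rightarrow> 'k::field mat \<Rightarrow> nat \<Rightarrow> 'k mpoly" where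
  "linear_map n A = (\<lambda>i\<in>{1..n}. \<Sum>j\<in>{1..n}. mconst (A $$ (i - 1, j - 1)) * mvar j)"

lemma linear_map_closed: "linear_map n A \<in> aff_endos n"
  unfolding linear_map_def aff_endos_def by (auto intro!: polys_in_intros)

lemma linear_map_apply:
  "i \<in> {1..n} \<Longrightarrow> linear_map n A i = (\<Sum>j\<in>{1..n}. mconst (A $$ (i - 1, j - 1)) * mvar j)"
  by (simp add: linear_map_def)

lemma sum_shift: "(\<Sum>j\<in>{1..n}. f (j - 1)) = (\<Sum>j<n::nat. f j)"
  by (rule sum.reindex_bij_witness[where i = Suc and j = "\<lambda>j. j - 1"]) auto

lemma linear_map_inverse:
  assumes A: "A \<in> carrier_mat n n" and B: "B \<in> carrier_mat n n" and AB: "A * B = 1\<^sub>m n"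
    and i: "i \<in> {1..n}"
  shows "subst (linear_map n B) (linear_map n A i) = mvar i"
proof -
  have "subst (linear_map n B) (linear_forms {1..n} (\<lambda>i j. A $$ (i - 1, j - 1)) i) = mvar i"
  proof (rule linear_forms_inverse[where B = "\<lambda>i j. B $$ (i - 1, j - 1)"])
    fix k assume k: "k \<in> {1..n}"
    have "(\<Sum>j\<in>{1..n}. A $$ (i - 1, j - 1) * B $$ (j - 1, k - 1)) = (A * B) $$ (i - 1, k - 1)"
      using A B i k sum_shift[of "\<lambda>j. A $$ (i - 1, j) * B $$ (j, k - 1)" n]
      by (auto simp: scalar_prod_def atLeast0LessThan)
    then show "(\<Sum>j\<in>{1..n}. A $$ (i - 1, j - 1) * B $$ (j - 1, k - 1)) = (if i = k then 1 else 0)"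
      using i k by (auto simp: AB)
  qed (use i in \<open>auto simp: linear_map_def linear_forms_def\<close>)
  then show ?thesis using i by (simp add: linear_map_apply linear_forms_def)
qed

lemma GL_autsE:
  assumes "f \<in> GL_auts n"
  obtains A B where "A \<in> carrier_mat n n" "B \<in> carrier_mat n n" "A * B = 1\<^sub>m n" "B * A = 1\<^sub>m n"
    "f = linear_map n A"
proof -
  from assms obtain A where A: "A \<in> carrier_mat n n" "invertible_mat A" "f = linear_map n A"
    by (auto simp: GL_auts_def linear_map_def)
  then obtain B where AB: "A * B = 1\<^sub>m n" and BA: "B * A = 1\<^sub>m (dim_row B)"
    by (auto simp: invertible_mat_def inverts_mat_def)
  \<comment> \<open>Invertibility by itself leaves the size of \<open>B\<close> open; comparing the
    numbers of columns in both products fixes it.\<close>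
  have "dim_col B = n" using arg_cong[OF AB, of dim_col] by simp
  moreover have "dim_row B = n" using arg_cong[OF BA, of dim_col] A(1) by simp
  ultimately have "B \<in> carrier_mat n n" by auto
  with A AB BA that show ?thesis by auto
qed

lemma preserves_orbit_linear:
  assumes AB: "A \<in> carrier_mat n n" "B \<in> carrier_mat n n" "A * B = 1\<^sub>m n" "B * A = 1\<^sub>m n"
  shows "preserves_orbit n (linear_map n A)"
  unfolding preserves_orbit_def
proof (intro allI impI)
  fix \<phi> :: "nat \<Rightarrow> 'a mpoly fract" assume \<phi>: "free_point n \<phi>" "orbit n \<phi>"
  \<comment> \<open>Adjoining the fixed coordinate \<open>x_0\<close> makes the affine linear map a
    linear automorphism of projective space.\<close>
  define l where "l A i = (if i = 0 then mvar 0 else linear_map n A i)" for A :: "'a mat" and i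
  have 1: "l A i \<in> polys_in {0..n} \<and> homogeneous 1 (l A i)" if "i \<le> n" for A i
    using that polys_in_mono[OF _ aff_endosD[OF linear_map_closed], of n "{0..n}" i]
    by (auto simp: l_def linear_map_apply
        intro!: polys_in_mvar homogeneous_mvar homogeneous_sum homogeneous_mconst_mult)
  have 2: "subst (l B) (l A i) = mvar i"
    if "A \<in> carrier_mat n n" "B \<in> carrier_mat n n" "A * B = 1\<^sub>m n" "i \<le> n" for A B i
  proof (cases "i = 0")
    case False
    then have "subst (l B) (linear_map n A i) = subst (linear_map n B) (linear_map n A i)"
      using that by (intro subst_cong[OF aff_endosD[OF linear_map_closed]]) (auto simp: l_def)
    with False linear_map_inverse[OF that(1-3), of i] that(4) show ?thesis by (simp add: l_def)
  qed (simp add: l_def)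
  have "linear_pair n (l A) (l B)"
    using 1 2[OF AB(1-3)] 2[OF AB(2,1,4)] by (simp add: linear_pair_def)
  from orbit_linear[OF this \<phi>(2)] show "orbit n (affine_image (linear_map n A) \<phi>)"
    by (rule orbit_cong)
      (use \<phi>(1) in \<open>auto simp: affine_image_def l_def free_point_def const_frac_insertion_simps\<close>)
qed

section \<open>Elementary automorphisms\<close>

definition elementary_map :: "nat \<Rightarrow> 'k::field mpoly \<Rightarrow> nat \<Rightarrow> 'k mpoly" where
  "elementary_map n p = (\<lambda>i\<in>{1..n}. if i = 1 then mvar 1 + p else mvar i)"

lemma elementary_map_closed: "p \<in> polys_in {2..n} \<Longrightarrow> elementary_map n p \<in> aff_endos n"
  using polys_in_mono[of "{2..n}" "{1..n}" p]
  by (auto simp: elementary_map_def aff_endos_def intro!: polys_in_intros)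

lemma elementary_map_inverse:
  assumes p: "p \<in> polys_in {2..n}"
  shows "aff_comp n (elementary_map n p) (elementary_map n (- p)) = aff_id n"
proof (rule aff_endos_ext[of _ n])
  fix i assume i: "i \<in> {1..n}"
  have "subst (elementary_map n (- p)) p = p"
    by (rule subst_eq_self[OF p]) (auto simp: elementary_map_def)
  with i show "aff_comp n (elementary_map n p) (elementary_map n (- p)) i = aff_id n i"
    by (simp add: aff_comp_apply aff_id_def elementary_map_def subst_simps)
qed (use p in \<open>auto intro: aff_comp_closed elementary_map_closed aff_id_closed polys_in_uminus\<close>)

text \<open>The subfield generated over the constants by the coordinates of \<open>\<phi>\<close>
  from 2 to \<open>n\<close>.\<close>

definition coordinate_field :: "nat \<Rightarrow> (nat \<Rightarrow> 'k::field mpoly fract) \<Rightarrow> 'k mpoly fract set" where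
  "coordinate_field n \<phi> = {insertion const_frac \<phi> a / insertion const_frac \<phi> b | a b.
     a \<in> polys_in {2..n} \<and> b \<in> polys_in {2..n} \<and> insertion const_frac \<phi> b \<noteq> 0}"

lemma coordinate_fieldI:
  assumes "a \<in> polys_in {2..n}" "b \<in> polys_in {2..n}" "insertion const_frac \<phi> b \<noteq> 0"
    "x = insertion const_frac \<phi> a / insertion const_frac \<phi> b"
  shows "x \<in> coordinate_field n \<phi>"
  using assms unfolding coordinate_field_def by blast

lemma coordinate_fieldE:
  assumes "x \<in> coordinate_field n \<phi>"
  obtains a b where "a \<in> polys_in {2..n}" "b \<in> polys_in {2..n}" "insertion const_frac \<phi> b \<noteq> 0"
    "x = insertion const_frac \<phi> a / insertion const_frac \<phi> b"
  using assms unfolding coordinate_field_def by blast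

lemma insertion_in_coordinate_field:
  "p \<in> polys_in {2..n} \<Longrightarrow> insertion const_frac \<phi> p \<in> coordinate_field n \<phi>"
  by (rule coordinate_fieldI[of p n 1]) (auto simp: const_frac_insertion_simps polys_in_1)

lemma coefficient_field_coordinate_field: "coefficient_field (coordinate_field n \<phi>)"
proof
  fix c
  show "const_frac c \<in> coordinate_field n \<phi>"
    using insertion_in_coordinate_field[OF polys_in_mconst[of c "{2..n}"], of \<phi>]
    by (simp add: const_frac_insertion_simps)
next
  fix x y assume "x \<in> coordinate_field n \<phi>" "y \<in> coordinate_field n \<phi>"
  then obtain a b c d where
    x: "a \<in> polys_in {2..n}" "b \<in> polys_in {2..n}" "insertion const_frac \<phi> b \<noteq> 0"
      "x = insertion const_frac \<phi> a / insertion const_frac \<phi> b" and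
    y: "c \<in> polys_in {2..n}" "d \<in> polys_in {2..n}" "insertion const_frac \<phi> d \<noteq> 0"
      "y = insertion const_frac \<phi> c / insertion const_frac \<phi> d"
    by (auto elim!: coordinate_fieldE)
  show "x + y \<in> coordinate_field n \<phi>"
    by (rule coordinate_fieldI[of "a * d + c * b" n "b * d"])
      (use x y in \<open>auto simp: const_frac_insertion_simps add_frac_eq intro: polys_in_add polys_in_mult\<close>)
  show "x * y \<in> coordinate_field n \<phi>"
    by (rule coordinate_fieldI[of "a * c" n "b * d"])
      (use x y in \<open>auto simp: const_frac_insertion_simps intro: polys_in_mult\<close>)
next
  fix x assume "x \<in> coordinate_field n \<phi>"
  then obtain a b where
    x: "a \<in> polys_in {2..n}" "b \<in> polys_in {2..n}" "insertion const_frac \<phi> b \<noteq> 0"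
      "x = insertion const_frac \<phi> a / insertion const_frac \<phi> b"
    by (rule coordinate_fieldE)
  show "inverse x \<in> coordinate_field n \<phi>"
  proof (cases "insertion const_frac \<phi> a = 0")
    \<comment> \<open>Division by zero gives zero, so the inverse is 0 here.\<close>
    case True
    with x insertion_in_coordinate_field[OF polys_in_0[of "{2..n}"], of \<phi>] show ?thesis
      by (simp add: const_frac_insertion_simps)
  next
    case False
    with x show ?thesis by (intro coordinate_fieldI[of b n a]) auto
  qed
qed

lemma mvar_neq_mconst: "mvar j \<noteq> mconst (c :: 'k::field)"
proof
  assume "mvar j = mconst c"
  \<comment> \<open>Substituting \<open>c + 1\<close> for the variable would give
    \<open>c + 1 = c\<close>.\<close>
  then have "subst (\<lambda>_. mconst (c + 1)) (mvar j) = subst (\<lambda>_. mconst (c + 1)) (mconst c)" by simp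
  then show False by (simp add: mconst_simps)
qed

text \<open>Algebraic independence turns a quotient representation of the first coordinate into the
  identity \<open>x_1 b = a\<close>. Setting \<open>x_1\<close> to 0 fixes \<open>a\<close> and
  kills the left side, so \<open>a\<close> and then \<open>b\<close> vanish.\<close>

lemma first_coordinate_notin:
  assumes \<phi>: "free_point n \<phi>" and n: "1 \<le> n"
  shows "\<phi> 1 \<notin> coordinate_field n \<phi>"
proof
  assume "\<phi> 1 \<in> coordinate_field n \<phi>"
  then obtain a b where ab: "a \<in> polys_in {2..n}" "b \<in> polys_in {2..n}" "insertion const_frac \<phi> b \<noteq> 0"
      "\<phi> 1 = insertion const_frac \<phi> a / insertion const_frac \<phi> b"
    by (rule coordinate_fieldE)
  then have "insertion const_frac \<phi> (mvar 1 * b - a) = 0"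
    by (simp add: const_frac_insertion_simps)
  moreover have "mvar 1 * b - a \<in> polys_in {1..n}"
    using ab(1,2) polys_in_mono[of "{2..n}" "{1..n}"] n by (auto intro!: polys_in_intros)
  ultimately have eq: "mvar 1 * b = a" using \<phi> by (auto simp: free_point_def)
  have "subst (mvar(1 := 0)) a = a"
    by (rule subst_eq_self[OF ab(1)]) auto
  then have "a = subst (mvar(1 := 0)) (mvar 1 * b)" by (simp only: eq)
  then have "a = 0" by (simp add: subst_simps)
  with ab \<phi> eq show False by (auto simp: const_frac_insertion_simps)
qed

lemma preserves_orbit_elementary:
  assumes char: "(2 :: 'k::field) \<noteq> 0" and n: "2 \<le> n" and p: "p \<in> polys_in {2..n}"
  shows "preserves_orbit n (elementary_map n (p :: 'k mpoly))"
  unfolding preserves_orbit_def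
proof (intro allI impI)
  fix \<phi> :: "nat \<Rightarrow> 'k mpoly fract" assume \<phi>: "free_point n \<phi>" "orbit n \<phi>"
  \<comment> \<open>A free point has nonconstant coordinates, so the results on addable elements
    hold over the field of its coordinates from 2 on.\<close>
  interpret generic_coordinates "coordinate_field n \<phi>" n \<phi>
  proof (intro generic_coordinates.intro generic_coordinates_axioms.intro coefficient_field_coordinate_field)
    fix j assume j: "2 \<le> j" "j \<le> n"
    show "\<phi> j \<in> coordinate_field n \<phi>"
      using insertion_in_coordinate_field[OF polys_in_mvar, of j n \<phi>] j
      by (simp add: const_frac_insertion_simps)
    fix c :: 'k
    have "mvar j - mconst c \<in> polys_in {1..n}"
      using j by (intro polys_in_intros) auto
    moreover have "mvar j - mconst c \<noteq> 0" by (simp add: mvar_neq_mconst)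
    ultimately have "insertion const_frac \<phi> (mvar j - mconst c) \<noteq> 0"
      using \<phi>(1) unfolding free_point_def by blast
    then show "\<phi> j \<noteq> const_frac c" by (simp add: const_frac_insertion_simps)
  qed (use n \<phi> in \<open>auto simp: free_point_def\<close>)
  have "orbit n (\<phi>(1 := \<phi> 1 + insertion const_frac \<phi> p))"
    using first_coordinate_notin[OF \<phi>(1)] n \<phi>(2)
    by (intro addableD[OF addable_insertion[OF char p]]) auto
  then show "orbit n (affine_image (elementary_map n p) \<phi>)"
    by (rule orbit_cong)
      (auto simp: affine_image_def elementary_map_def const_frac_insertion_simps zeroth)
qed

lemma TAut_preserves_orbit:
  assumes char: "(2 :: 'k::field) \<noteq> 0" and n: "2 \<le> n" and f: "f \<in> TAut n"
  shows "f \<in> carrier (Aut_A n)" "preserves_orbit n (f :: nat \<Rightarrow> 'k mpoly)"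
proof -
  interpret group "Aut_A n :: (nat \<Rightarrow> 'k mpoly) monoid" by (rule group_Aut_A)
  \<comment> \<open>Inverses are treated together with the generators. They are of the same kind:
    the inverse matrix, or the polynomial \<open>- p\<close>.\<close>
  have gen: "h \<in> carrier (Aut_A n) \<and> preserves_orbit n h \<and> preserves_orbit n (inv\<^bsub>Aut_A n\<^esub> h)"
    if "h \<in> GL_auts n \<union> elementary_auts n" for h :: "nat \<Rightarrow> 'k mpoly"
    using that
  proof
    assume "h \<in> GL_auts n"
    then obtain A B where AB: "A \<in> carrier_mat n n" "B \<in> carrier_mat n n" "A * B = 1\<^sub>m n" "B * A = 1\<^sub>m n"
      and h: "h = linear_map n A"
      by (rule GL_autsE)
    have comp: "aff_comp n (linear_map n A) (linear_map n B) = aff_id n"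
      if "A \<in> carrier_mat n n" "B \<in> carrier_mat n n" "A * B = 1\<^sub>m n" for A B :: "'k mat"
      by (rule aff_endos_ext[of _ n])
        (intro aff_comp_closed linear_map_closed aff_id_closed |
         simp only: aff_comp_apply linear_map_inverse[OF that] aff_id_def restrict_apply if_True)+
    note inv = Aut_A_inverse[OF linear_map_closed linear_map_closed comp[OF AB(1-3)] comp[OF AB(2,1,4)]]
    show ?thesis
      unfolding h inv(2)
      using inv(1) preserves_orbit_linear[OF AB] preserves_orbit_linear[OF AB(2,1,4,3)] by simp
  next
    assume "h \<in> elementary_auts n"
    then obtain p where p: "p \<in> polys_in {2..n}" and h: "h = elementary_map n p"
      by (auto simp: elementary_auts_def elementary_map_def)
    have p': "- p \<in> polys_in {2..n}" by (rule polys_in_uminus[OF p])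
    have "aff_comp n (elementary_map n (- p)) (elementary_map n p) = aff_id n"
      using elementary_map_inverse[OF p'] by simp
    note inv = Aut_A_inverse[OF elementary_map_closed[OF p] elementary_map_closed[OF p']
        elementary_map_inverse[OF p] this]
    show ?thesis
      unfolding h inv(2)
      using inv(1) preserves_orbit_elementary[OF char n p] preserves_orbit_elementary[OF char n p'] by simp
  qed
  have "f \<in> carrier (Aut_A n) \<and> preserves_orbit n f"
    using f unfolding TAut_def
  proof (induction rule: generate.induct)
    case one
    have "\<one>\<^bsub>Aut_A n\<^esub> = (aff_id n :: nat \<Rightarrow> 'k mpoly)" by (simp add: Aut_A_def)
    then show ?case using one_closed preserves_orbit_id by simp
  next
    case (eng h1 h2)
    have "h1 \<otimes>\<^bsub>Aut_A n\<^esub> h2 = aff_comp n h1 h2" by (simp add: Aut_A_def)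
    with eng show ?case using m_closed[of h1 h2] preserves_orbit_comp[of h1 n h2] by simp
  qed (use gen inv_closed in blast)+
  then show "f \<in> carrier (Aut_A n)" "preserves_orbit n f" by simp_all
qed

section \<open>Linear embeddings\<close>

lemma infinite_alg_closed: "infinite (UNIV :: 'a::alg_closed_field set)"
proof
  assume fin: "finite (UNIV :: 'a set)"
  \<comment> \<open>Euclid's argument: over a finite field this product vanishes everywhere, so
    adding 1 gives a nonconstant polynomial without roots.\<close>
  let ?q = "\<Prod>a\<in>(UNIV :: 'a set). [:- a, 1:]"
  have deg: "Polynomial.degree ?q = card (UNIV :: 'a set)"
    using fin by (subst degree_prod_eq_sum_degree) auto
  have "card (UNIV :: 'a set) > 0" using fin by (simp add: card_gt_0_iff)
  then have "Polynomial.degree (?q + 1) > 0"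
    by (subst degree_add_eq_left) (simp_all add: deg)
  then obtain z where "Polynomial.poly (?q + 1) z = 0"
    using alg_closed_imp_poly_has_root by blast
  moreover have "Polynomial.poly ?q z = 0"
    using fin by (auto simp: poly_prod)
  ultimately show False by simp
qed

text \<open>Reduction modulo \<open>B\<close> isolates the lowest digit, and dividing the rest by
  \<open>B\<close> shifts the remaining digits down. This gives uniqueness of expansions in base
  \<open>B\<close>.\<close>

lemma digits_eq:
  fixes f g :: "nat \<Rightarrow> nat"
  assumes "(\<Sum>i<N. f i * B ^ i) = (\<Sum>i<N. g i * B ^ i)" "\<And>i. f i < B" "\<And>i. g i < B" "i < N"
  shows "f i = g i"
  using assms
proof (induction N arbitrary: f g i)
  case (Suc N)
  have step: "(\<Sum>i<Suc N. f i * B ^ i) = f 0 + B * (\<Sum>i<N. f (Suc i) * B ^ i)" for f :: "nat \<Rightarrow> nat"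
    by (simp add: sum.lessThan_Suc_shift sum_distrib_left mult_ac del: sum.lessThan_Suc)
  have eq: "f 0 + B * (\<Sum>i<N. f (Suc i) * B ^ i) = g 0 + B * (\<Sum>i<N. g (Suc i) * B ^ i)"
    using Suc.prems(1) by (simp only: step)
  have f0: "f 0 = g 0"
    using arg_cong[OF eq, of "\<lambda>x. x mod B"] Suc.prems(2)[of 0] Suc.prems(3)[of 0] by simp
  moreover have "B \<noteq> 0" using Suc.prems(2)[of 0] by auto
  ultimately have "(\<Sum>i<N. f (Suc i) * B ^ i) = (\<Sum>i<N. g (Suc i) * B ^ i)"
    using eq by simp
  then have "f (Suc j) = g (Suc j)" if "j < N" for j
    using Suc.IH[of "\<lambda>i. f (Suc i)" "\<lambda>i. g (Suc i)" j] Suc.prems that by simp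
  with f0 Suc.prems(4) show ?case by (cases i) auto
qed simp

text \<open>Kronecker's substitution \<open>x\<^sub>i \<mapsto> T ^ (B ^ i)\<close>, with \<open>B\<close> larger than all exponents of \<open>q\<close>,
  separates the monomials of \<open>q\<close>.\<close>

lemma nonvanishing_point:
  fixes q :: "'k::field mpoly"
  assumes inf: "infinite (UNIV :: 'k set)" and q: "q \<in> polys_in {..<N}" "q \<noteq> 0"
  shows "\<exists>a. insertion id a q \<noteq> 0"
proof -
  \<comment> \<open>A crude bound suffices: each exponent is at most the degree of its monomial,
    hence at most the sum of all degrees.\<close>
  define B where "B = Suc (\<Sum>m\<in>Poly_Mapping.keys q. monom_degree m)"
  define w where "w m = (\<Sum>i<N. Poly_Mapping.lookup m i * B ^ i)" for m :: "nat \<Rightarrow>\<^sub>0 nat"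
  have lt: "Poly_Mapping.lookup m i < B" if "m \<in> Poly_Mapping.keys q" for m i
  proof -
    have "Poly_Mapping.lookup m i \<le> monom_degree m"
      by (cases "i \<in> Poly_Mapping.keys m") (auto simp: monom_degree_def in_keys_iff intro: member_le_sum)
    also have "\<dots> \<le> (\<Sum>m\<in>Poly_Mapping.keys q. monom_degree m)"
      using that by (intro member_le_sum) auto
    finally show ?thesis by (simp add: B_def)
  qed
  have inj: "m = m'" if "m \<in> Poly_Mapping.keys q" "m' \<in> Poly_Mapping.keys q" "w m = w m'" for m m'
  proof (rule poly_mapping_eqI)
    fix i
    have "i \<notin> Poly_Mapping.keys m \<and> i \<notin> Poly_Mapping.keys m'" if "\<not> i < N"
      using that q(1) \<open>m \<in> _\<close> \<open>m' \<in> _\<close> by (auto simp: polys_in_def)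
    then show "Poly_Mapping.lookup m i = Poly_Mapping.lookup m' i"
      using digits_eq[of "Poly_Mapping.lookup m" B N "Poly_Mapping.lookup m'" i] that lt
      by (cases "i < N") (auto simp: w_def in_keys_iff)
  qed
  have rm: "ring_map (\<lambda>c::'k. [:c:])" by (simp add: ring_map_def one_pCons)
  define P where "P = insertion (\<lambda>c. [:c:]) (\<lambda>i. Polynomial.monom 1 (B ^ i)) q"
  have P: "P = (\<Sum>m\<in>Poly_Mapping.keys q. Polynomial.monom (Poly_Mapping.lookup q m) (w m))"
  proof -
    have "P = (\<Sum>m\<in>Poly_Mapping.keys q. [:Poly_Mapping.lookup q m:] *
        monom_val (\<lambda>i. Polynomial.monom 1 (B ^ i)) m)"
      unfolding P_def by (rule insertion_superset) simp_all
    also have "\<dots> = (\<Sum>m\<in>Poly_Mapping.keys q. Polynomial.monom (Poly_Mapping.lookup q m) (w m))"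
    proof (rule sum.cong)
      fix m assume m: "m \<in> Poly_Mapping.keys q"
      have "(\<Prod>i\<in>S. Polynomial.monom 1 (B ^ i) ^ Poly_Mapping.lookup m i)
          = Polynomial.monom (1::'k) (\<Sum>i\<in>S. Poly_Mapping.lookup m i * B ^ i)" if "finite S" for S
        using that by (induction S) (auto simp: monom_power mult_monom mult.commute)
      moreover have "Poly_Mapping.keys m \<subseteq> {..<N}" using q(1) m by (auto simp: polys_in_def)
      ultimately have "monom_val (\<lambda>i. Polynomial.monom (1::'k) (B ^ i)) m = Polynomial.monom 1 (w m)"
        by (subst monom_val_superset[of "{..<N}"]) (auto simp: w_def)
      then show "[:Poly_Mapping.lookup q m:] * monom_val (\<lambda>i. Polynomial.monom 1 (B ^ i)) m
          = Polynomial.monom (Poly_Mapping.lookup q m) (w m)"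
        by (simp add: smult_monom)
    qed simp
    finally show ?thesis .
  qed
  obtain m where m: "m \<in> Poly_Mapping.keys q" using q(2) by (metis ex_in_conv keys_eq_empty)
  \<comment> \<open>No two monomials of \<open>q\<close> share the exponent \<open>w m\<close>, so
    this coefficient of \<open>P\<close> is a single coefficient of \<open>q\<close>.\<close>
  have "Polynomial.coeff P (w m) = (\<Sum>m'\<in>Poly_Mapping.keys q. if m' = m then Poly_Mapping.lookup q m else 0)"
    unfolding P coeff_sum by (intro sum.cong) (use inj m in \<open>auto\<close>)
  also have "\<dots> \<noteq> 0" using m by (simp add: in_keys_iff)
  finally have "P \<noteq> 0" by auto
  then have "finite {x. Polynomial.poly P x = 0}" by (rule poly_roots_finite)
  with inf have "{x. Polynomial.poly P x = 0} \<noteq> UNIV" by auto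
  then obtain x where "Polynomial.poly P x \<noteq> 0" by blast
  moreover have "ring_map (\<lambda>p. Polynomial.poly p x)" by (simp add: ring_map_def)
  then have "Polynomial.poly P x = insertion (\<lambda>c. c) (\<lambda>i. x ^ (B ^ i)) q"
    using ring_map_of_insertion[of "\<lambda>p. Polynomial.poly p x" "\<lambda>c. [:c:]" _ q]
    unfolding P_def by (simp add: poly_monom)
  ultimately show ?thesis by (auto simp: id_def)
qed

section \<open>Degrees of the components of a linear embedding\<close>

lemma lookup_mconst_mult: "Poly_Mapping.lookup (mconst c * p) m = c * Poly_Mapping.lookup p m"
  by (induction p rule: mpoly_induct)
    (simp_all add: distrib_left lookup_add mconst_def mult_single lookup_single when_def)

lemma lookup_insertion_to_ac:
  "Poly_Mapping.lookup (insertion (\<lambda>c. mconst (to_ac c)) mvar p) m = to_ac (Poly_Mapping.lookup p m)"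
proof -
  have rm: "ring_map (\<lambda>c. mconst (to_ac c))" by (rule ring_map_comp[OF ring_map_mconst ring_map_to_ac])
  show ?thesis
    by (induction p rule: mpoly_induct)
      (simp_all add: insertion_add rm insertion_single mconst_simps lookup_add lookup_single when_def
        flip: single_eq_mconst_mult)
qed

text \<open>A monomial of degree at least 2 in some component survives in a general linear
  combination of the components. The algebraic closure is infinite, so some \<open>a\<close> avoids
  both the zeros of \<open>q\<close> and the cancellation of that monomial.\<close>

lemma pulls_back_degree:
  fixes t :: "nat \<Rightarrow> 'k::field mpoly"
  assumes t: "pulls_back_general_hyperplane n t" and i: "i \<le> n"
    and m: "m \<in> Poly_Mapping.keys (t i)"
  shows "monom_degree m \<le> 1"
proof (rule ccontr)
  assume deg: "\<not> monom_degree m \<le> 1"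
  from t obtain q :: "'k alg_closure mpoly" where q: "q \<in> polys_in {0..n}" "q \<noteq> 0"
    and deg1: "\<And>a. \<exists>i\<le>n. a i \<noteq> 0 \<Longrightarrow> insertion id a q \<noteq> 0 \<Longrightarrow>
      total_degree (\<Sum>i\<le>n. mconst (a i) * insertion (\<lambda>c. mconst (to_ac c)) mvar (t i)) = 1"
    unfolding pulls_back_general_hyperplane_def by blast
  note ev = insertion_simps[OF ring_map_id] insertion_mconst[OF ring_map_id]
    insertion_mvar[OF ring_map_id]
  \<comment> \<open>As a linear form in \<open>a\<close>, this is the coefficient of
    \<open>m\<close> in the pulled back hyperplane equation.\<close>
  define l where "l = (\<Sum>j\<le>n. mconst (to_ac (Poly_Mapping.lookup (t j) m)) * mvar j)"
  have l: "insertion id a l = (\<Sum>j\<le>n. to_ac (Poly_Mapping.lookup (t j) m) * a j)" for a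
    by (simp add: l_def ev)
  have "insertion id (\<lambda>j. if j = i then 1 else 0) l = to_ac (Poly_Mapping.lookup (t i) m)"
    using i by (simp add: l if_distrib cong: if_cong)
  with m have "l \<noteq> 0" by (auto simp: ev in_keys_iff)
  then have "q * l \<noteq> 0" using q(2) by simp
  moreover have "q * l \<in> polys_in {..<Suc n}"
    unfolding l_def by (intro polys_in_intros polys_in_mono[OF _ q(1)]) auto
  ultimately obtain a where a: "insertion id a (q * l) \<noteq> 0"
    using nonvanishing_point infinite_alg_closed by blast
  then have q_a: "insertion id a q \<noteq> 0" and l_a: "insertion id a l \<noteq> 0"
    by (simp_all add: ev)
  have "\<exists>j\<le>n. a j \<noteq> 0"
  proof (rule ccontr)
    assume "\<not> ?thesis"
    then have "insertion id a l = 0" unfolding l by (intro sum.neutral) auto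
    with l_a show False by simp
  qed
  then have "total_degree (\<Sum>i\<le>n. mconst (a i) * insertion (\<lambda>c. mconst (to_ac c)) mvar (t i)) = 1" (is "total_degree ?S = 1")
    using q_a by (rule deg1)
  moreover have "Poly_Mapping.lookup ?S m = insertion id a l"
    by (simp add: lookup_sum lookup_mconst_mult lookup_insertion_to_ac l mult.commute)
  with l_a have "m \<in> Poly_Mapping.keys ?S" by (simp add: in_keys_iff)
  then have "monom_degree m \<le> total_degree ?S" unfolding total_degree_def by (intro Max_ge) auto
  ultimately show False using deg by simp
qed

section \<open>The inverse of an embedding as a point, and linear coordinates\<close>

definition affine_point :: "(nat \<Rightarrow> 'k::field mpoly) \<Rightarrow> nat \<Rightarrow> 'k mpoly fract" where
  "affine_point h i = to_frac (h i) / to_frac (h 0)"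

lemma pullback_eq: "pullback h p = insertion const_frac (affine_point h) p"
  by (simp add: pullback_def affine_point_def[abs_def])

text \<open>After clearing denominators, a power of \<open>h 0\<close> times the value of
  \<open>p\<close> is a polynomial \<open>P\<close>, and substituting \<open>t\<close> turns
  \<open>P\<close> into a nonzero multiple of \<open>p\<close>. So a vanishing value forces
  \<open>p = 0\<close>.\<close>

lemma rat_inverse_free_point:
  assumes h: "h \<in> rat_inverse n t"
  shows "free_point n (affine_point h)"
proof -
  have h0: "h 0 \<noteq> 0" and th0: "subst t (h 0) \<noteq> 0"
    and th: "\<And>i. i \<in> {1..n} \<Longrightarrow> subst t (h i) = mvar i * subst t (h 0)"
    using h unfolding rat_inverse_def by blast+
  have h_eq: "to_frac (h i) = to_frac (h 0) * affine_point h i" for i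
    using h0 by (simp add: affine_point_def)
  have "\<exists>N P. to_frac P = to_frac (h 0) ^ N * insertion const_frac (affine_point h) p
      \<and> subst t P = subst t (h 0) ^ N * p" if "p \<in> polys_in {1..n}" for p
    using that
  proof (induction p rule: polys_in_induct)
    case (mconst c)
    show ?case by (intro exI[of _ 0] exI[of _ "mconst c"]) (simp add: const_frac_insertion_simps)
  next
    case (mvar_mult i q)
    then obtain N P where "to_frac P = to_frac (h 0) ^ N * insertion const_frac (affine_point h) q"
      "subst t P = subst t (h 0) ^ N * q" by blast
    then show ?case
      using th[OF mvar_mult(1)] h_eq[of i]
      by (intro exI[of _ "Suc N"] exI[of _ "h i * P"])
        (simp add: to_frac_simps subst_simps const_frac_insertion_simps mult_ac)
  next
    case (add p q)
    then obtain N P M Q where "to_frac P = to_frac (h 0) ^ N * insertion const_frac (affine_point h) p"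
      "subst t P = subst t (h 0) ^ N * p"
      "to_frac Q = to_frac (h 0) ^ M * insertion const_frac (affine_point h) q"
      "subst t Q = subst t (h 0) ^ M * q" by blast
    then show ?case
      by (intro exI[of _ "N + M"] exI[of _ "h 0 ^ M * P + h 0 ^ N * Q"])
        (simp add: to_frac_simps subst_simps const_frac_insertion_simps power_add algebra_simps)
  qed
  then have "p = 0" if "p \<in> polys_in {1..n}" "insertion const_frac (affine_point h) p = 0" for p
    using that th0 by (metis mult_zero_right mult_eq_0_iff power_not_zero subst_simps(4) to_frac_eq_0_iff)
  then show ?thesis
    using h0 by (simp add: free_point_def affine_point_def)
qed

lemma linear_embedding_coordinates:
  fixes t :: "nat \<Rightarrow> 'k::field mpoly"
  assumes t: "linear_embedding n t"
  obtains l l' where "linear_pair n l l'"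
    "\<And>\<phi> i. \<phi> 0 = 1 \<Longrightarrow> i \<le> n \<Longrightarrow> insertion const_frac \<phi> (t i) = insertion const_frac \<phi> (l i)"
proof -
  \<comment> \<open>The index \<open>j = 0\<close> selects the constant term: row \<open>i\<close>
    will be the homogenisation of \<open>t i\<close> by \<open>x_0\<close>.\<close>
  define A where "A i j = Poly_Mapping.lookup (t i) (if j = 0 then 0 else Poly_Mapping.single j 1)" for i j
  have tin: "t i \<in> polys_in {1..n}" if "i \<le> n" for i
    using t that by (auto simp: linear_embedding_def open_embedding_def morphism_A_P_def)
  have split: "(\<Sum>j\<in>{0..n}. f j) = f 0 + (\<Sum>j\<in>{1..n}. f j)" for f :: "nat \<Rightarrow> 'a::comm_monoid_add"
    by (simp add: sum.atLeast_Suc_atMost)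
  have eval: "insertion const_frac \<phi> (t i) = insertion const_frac \<phi> (linear_forms {0..n} A i)"
    if "\<phi> 0 = 1" "i \<le> n" for \<phi> i
  proof -
    have "t i = mconst (A i 0) + (\<Sum>j\<in>{1..n}. mconst (A i j) * mvar j)"
      using affine_expansion[OF tin[OF that(2)]] pulls_back_degree[of n t i] t that(2)
      by (simp add: A_def linear_embedding_def)
    then show ?thesis
      using that(1) by (simp add: linear_forms_def split const_frac_insertion_simps)
  qed
  obtain h where h: "h \<in> rat_inverse n t"
    using t unfolding linear_embedding_def open_embedding_def by blast
  then have pr: "proportional n (\<lambda>i. pullback h (t i)) (\<lambda>i. to_frac (mvar i))" and h0: "h 0 \<noteq> 0"
    unfolding rat_inverse_def by blast+
  \<comment> \<open>A relation between the rows of \<open>A\<close> is a relation between the values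
    of \<open>t\<close> at the point given by \<open>h\<close>. These are proportional to the
    independent variables \<open>x_0, ..., x_n\<close>, so the relation is trivial.\<close>
  have indep: "v i = 0" if v: "\<And>j. j \<le> n \<Longrightarrow> (\<Sum>i\<in>{0..n}. v i * A i j) = 0" and i: "i \<le> n" for v i
  proof -
    define y where "y = affine_point h"
    have y0: "y 0 = 1" using h0 by (simp add: y_def affine_point_def)
    have "(\<Sum>i\<in>{0..n}. const_frac (v i) * pullback h (t i))
        = (\<Sum>i\<in>{0..n}. \<Sum>j\<in>{0..n}. const_frac (v i * A i j) * y j)"
      by (intro sum.cong refl)
        (simp add: pullback_eq eval y0 flip: y_def, simp add: linear_forms_def
          const_frac_insertion_simps const_frac_simps sum_distrib_left mult.assoc)
    also have "\<dots> = (\<Sum>j\<in>{0..n}. \<Sum>i\<in>{0..n}. const_frac (v i * A i j) * y j)"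
      by (rule sum.swap)
    also have "\<dots> = (\<Sum>j\<in>{0..n}. const_frac (\<Sum>i\<in>{0..n}. v i * A i j) * y j)"
      by (simp only: ring_map_sum[OF ring_map_const_frac] sum_distrib_right)
    also have "\<dots> = 0" by (intro sum.neutral) (simp add: v const_frac_simps)
    finally have zero: "(\<Sum>i\<in>{0..n}. const_frac (v i) * pullback h (t i)) = 0" .
    obtain m where m: "m \<le> n" "pullback h (t m) \<noteq> 0" using proportionalD(1)[OF pr] by blast
    have "pullback h (t m) * (\<Sum>i\<in>{0..n}. const_frac (v i) * to_frac (mvar i))
        = (\<Sum>i\<in>{0..n}. const_frac (v i) * (pullback h (t m) * to_frac (mvar i)))"
      by (simp add: sum_distrib_left mult_ac)
    also have "\<dots> = (\<Sum>i\<in>{0..n}. const_frac (v i) * (pullback h (t i) * to_frac (mvar m)))"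
      by (intro sum.cong refl arg_cong2[of _ _ _ _ "(*)"] proportionalD(3)[OF pr]) (use m in auto)
    also have "\<dots> = (\<Sum>i\<in>{0..n}. const_frac (v i) * pullback h (t i)) * to_frac (mvar m)"
      by (simp add: sum_distrib_right mult.assoc)
    finally have "to_frac (\<Sum>i\<in>{0..n}. mconst (v i) * mvar i) = 0"
      using zero m(2) by (simp add: to_frac_simps)
    \<comment> \<open>Setting \<open>x_i\<close> to 1 and the other variables to 0 isolates
      \<open>v i\<close>.\<close>
    then have "subst (\<lambda>j. if j = i then 1 else 0) (\<Sum>i\<in>{0..n}. mconst (v i) * mvar i) = 0"
      by (simp add: subst_simps)
    then show "v i = 0" using i by (simp add: subst_simps if_distrib cong: if_cong)
  qed
  define M where "M = mat (Suc n) (Suc n) (\<lambda>(i, j). A i j)"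
  have M: "M \<in> carrier_mat (Suc n) (Suc n)" by (simp add: M_def)
  have "det M \<noteq> 0"
  proof
    assume "det M = 0"
    \<comment> \<open>Relations between rows are kernel vectors of the transpose.\<close>
    then have "det M\<^sup>T = 0" by (simp add: det_transpose[OF M])
    then obtain v where v: "v \<in> carrier_vec (Suc n)" "v \<noteq> 0\<^sub>v (Suc n)" "M\<^sup>T *\<^sub>v v = 0\<^sub>v (Suc n)"
      using det_0_iff_vec_prod_zero_field[of "M\<^sup>T" "Suc n"] M by auto
    have "(\<Sum>i\<in>{0..n}. v $ i * A i j) = 0" if "j \<le> n" for j
    proof -
      have "(M\<^sup>T *\<^sub>v v) $ j = (\<Sum>i\<in>{0..n}. v $ i * A i j)"
        using v(1) that
        by (simp add: M_def scalar_prod_def mult.commute atLeast0_lessThan_Suc_eq_insert_0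
            flip: atLeastLessThanSuc_atLeastAtMost)
      then show ?thesis using v(3) that by simp
    qed
    then have "v $ i = 0" if "i \<le> n" for i using indep that by blast
    with v(1) have "v = 0\<^sub>v (Suc n)" by (intro eq_vecI) auto
    with v(2) show False by simp
  qed
  then obtain B where B: "B \<in> carrier_mat (Suc n) (Suc n)" "M * B = 1\<^sub>m (Suc n)" "B * M = 1\<^sub>m (Suc n)"
    using det_non_zero_imp_unit[OF M, of "()"] unfolding Units_def ring_mat_simps by auto
  have entry: "(\<Sum>j\<in>{0..n}. C $$ (i, j) * D $$ (j, k)) = (if i = k then 1 else 0)"
    if "C \<in> carrier_mat (Suc n) (Suc n)" "D \<in> carrier_mat (Suc n) (Suc n)" "C * D = 1\<^sub>m (Suc n)"
      "i \<le> n" "k \<le> n" for C D :: "'k mat" and i k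
  proof -
    have "(C * D) $$ (i, k) = (\<Sum>j\<in>{0..n}. C $$ (i, j) * D $$ (j, k))"
      using that(1,2,4,5) by (auto simp: scalar_prod_def simp flip: atLeastLessThanSuc_atLeastAtMost)
    then show ?thesis using that by simp
  qed
  have AM: "A i j = M $$ (i, j)" if "i \<le> n" "j \<le> n" for i j using that by (simp add: M_def)
  define B' where "B' i j = B $$ (i, j)" for i j
  have "linear_pair n (linear_forms {0..n} A) (linear_forms {0..n} B')"
    unfolding linear_pair_def
  proof (intro conjI allI impI linear_forms_in linear_forms_homogeneous)
    fix i assume i: "i \<le> n"
    show "subst (linear_forms {0..n} A) (linear_forms {0..n} B' i) = mvar i"
      by (rule linear_forms_inverse[of _ _ _ A]) (use i entry[OF B(1) M B(3)] in \<open>auto simp: AM B'_def\<close>)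
    show "subst (linear_forms {0..n} B') (linear_forms {0..n} A i) = mvar i"
      by (rule linear_forms_inverse[of _ _ _ B']) (use i entry[OF M B(1,2)] in \<open>auto simp: AM B'_def\<close>)
  qed
  then show ?thesis using eval by (rule that)
qed

theorem proposition6p5:
  fixes n :: nat and \<tau> :: "nat \<Rightarrow> 'k::field mpoly"
  assumes "CHAR('k) \<noteq> 2"
    and "n \<ge> 2"
    and "linear_embedding n \<tau>"
  shows "conj_embedding n \<tau> ` TAut n \<subseteq> G_group n"
proof
  \<comment> \<open>If 2 were zero, the characteristic would divide 2; the divisor 1 is impossible
    and 2 is excluded by assumption.\<close>
  have "CHAR('k) \<noteq> 1" by simp
  then have "\<not> CHAR('k) dvd 2" using assms(1) by (metis prime_nat_iff two_is_prime_nat)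
  then have char: "(2 :: 'k) \<noteq> 0" using of_nat_eq_0_iff_char_dvd[of 2, where 'a = 'k] by simp
  obtain l l' where l: "linear_pair n l l'"
    and eval: "\<And>\<phi> i. \<phi> 0 = 1 \<Longrightarrow> i \<le> n \<Longrightarrow> insertion const_frac \<phi> (\<tau> i) = insertion const_frac \<phi> (l i)"
    using linear_embedding_coordinates[OF assms(3)] by blast
  have \<tau>in: "\<tau> i \<in> polys_in {1..n}" if "i \<le> n" for i
    using assms(3) that by (auto simp: linear_embedding_def open_embedding_def morphism_A_P_def)
  have l'_l: "insertion const_frac (\<lambda>i. insertion const_frac \<phi> (l i)) (l' j) = \<phi> j" if "j \<le> n" for \<phi> j
    using l that by (simp add: linear_pair_def const_frac_insertion_simps
        flip: insertion_subst[OF ring_map_const_frac])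
  \<comment> \<open>In the linear coordinates \<open>l\<close>, the identity
    \<open>\<tau> \<circ> h = id\<close> says that \<open>l\<close> maps the affine point of
    \<open>h\<close> to the generic point.\<close>
  have generic: "proportional n (\<lambda>i. insertion const_frac (affine_point h) (l i)) (\<lambda>i. to_frac (mvar i))"
    and zeroth: "affine_point h 0 = 1"
    and free: "free_point n (affine_point h)"
    if "h \<in> rat_inverse n \<tau>" for h
  proof -
    show free: "free_point n (affine_point h)" by (rule rat_inverse_free_point[OF that])
    then show 0: "affine_point h 0 = 1" by (simp add: free_point_def)
    have "proportional n (\<lambda>i. pullback h (\<tau> i)) (\<lambda>i. to_frac (mvar i))"
      using that unfolding rat_inverse_def by blast
    then show "proportional n (\<lambda>i. insertion const_frac (affine_point h) (l i)) (\<lambda>i. to_frac (mvar i))"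
      by (subst (asm) proportional_cong[of n _ "\<lambda>i. insertion const_frac (affine_point h) (l i)" _ "\<lambda>i. to_frac (mvar i)"])
        (simp_all add: pullback_eq eval[where \<phi> = "affine_point h", OF 0])
  qed
  \<comment> \<open>The affine point is the image of the generic point under the inverse linear
    automorphism \<open>l'\<close>.\<close>
  have orb: "orbit n (affine_point h)" if h: "h \<in> rat_inverse n \<tau>" for h
  proof -
    have "orbit n (\<lambda>i. insertion const_frac (affine_point h) (l i))"
      by (rule orbit_proportional[OF orbit_generic generic[OF h]])
    from orbit_linear[OF linear_pair_sym[OF l] this] show ?thesis
      by (rule orbit_cong) (simp add: l'_l)
  qed
  \<comment> \<open>The conjugate by the embedding is a union over all representatives of the
    inverse, so these must be shown to define the same affine point.\<close>
  have unique: "affine_point h i = affine_point h' i"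
    if h: "h \<in> rat_inverse n \<tau>" "h' \<in> rat_inverse n \<tau>" and i: "i \<le> n" for h h' i
  proof -
    have "proportional n (\<lambda>i. insertion const_frac (affine_point h) (l i))
        (\<lambda>i. insertion const_frac (affine_point h') (l i))"
      by (rule proportional_trans[OF generic[OF h(1)] proportional_sym[OF generic[OF h(2)]]])
    then have "proportional n
        (\<lambda>j. insertion const_frac (\<lambda>i. insertion const_frac (affine_point h) (l i)) (l' j))
        (\<lambda>j. insertion const_frac (\<lambda>i. insertion const_frac (affine_point h') (l i)) (l' j))"
      by (rule insertion_proportional[OF linear_pair_forms[OF linear_pair_sym[OF l]] _ ring_map_const_frac])
        (use zeroth[OF h(2)] in \<open>auto simp: l'_l intro!: exI[of _ 0]\<close>)
    \<comment> \<open>Both points have zeroth coordinate 1, so proportionality becomes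
      equality.\<close>
    from proportionalD(3)[OF this i, of 0] show ?thesis
      using i by (simp add: l'_l zeroth h)
  qed
  fix F assume "F \<in> conj_embedding n \<tau> ` TAut n"
  then obtain f where f: "f \<in> TAut n" and F: "F = conj_embedding n \<tau> f" by blast
  note f' = TAut_preserves_orbit[OF char assms(2) f]
  have fin: "subst f (\<tau> i) \<in> polys_in {1..n}" if "i \<le> n" for i
    using f'(1) by (intro polys_in_subst[OF \<tau>in[OF that]] aff_endosD) (auto simp: Aut_A_def)
  \<comment> \<open>The automorphism \<open>f\<close> keeps the affine point in the orbit, and
    \<open>l\<close> then carries the result back to projective coordinates.\<close>
  have orb_f: "orbit n (\<lambda>i. pullback h (subst f (\<tau> i)))" if h: "h \<in> rat_inverse n \<tau>" for h
  proof -
    have "orbit n (affine_image f (affine_point h))"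
      using f'(2) free[OF h] orb[OF h] by (simp add: preserves_orbit_def)
    from orbit_linear[OF l this] show ?thesis
    proof (rule orbit_cong)
      fix i assume i: "i \<le> n"
      have "affine_image f (affine_point h) 0 = 1" by (simp add: affine_image_def)
      from eval[where \<phi> = "affine_image f (affine_point h)", OF this i] show "pullback h (subst f (\<tau> i))
          = insertion const_frac (affine_image f (affine_point h)) (l i)"
        by (simp add: pullback_eq insertion_affine_image[OF \<tau>in[OF i]])
    qed
  qed
  obtain h where h: "h \<in> rat_inverse n \<tau>"
    using assms(3) unfolding linear_embedding_def open_embedding_def by blast
  \<comment> \<open>All members of the union agree, so it collapses to the rational map obtained
    from one \<open>h\<close>.\<close>
  have "rat_map n (\<lambda>i. pullback h' (subst f (\<tau> i))) = rat_map n (\<lambda>i. pullback h (subst f (\<tau> i)))"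
    if h': "h' \<in> rat_inverse n \<tau>" for h'
  proof (rule rat_map_eqI, rule proportional_scale[of 1])
    show "\<exists>i\<le>n. pullback h (subst f (\<tau> i)) \<noteq> 0" by (rule orbit_nonzero[OF orb_f[OF h]])
    fix i assume i: "i \<le> n"
    show "pullback h' (subst f (\<tau> i)) = 1 * pullback h (subst f (\<tau> i))"
      unfolding pullback_eq mult_1
      by (rule insertion_cong[OF fin[OF i]]) (auto intro: unique[OF h' h])
  qed simp
  then have "F = rat_map n (\<lambda>i. pullback h (subst f (\<tau> i)))"
    using h unfolding F conj_embedding_def by blast
  then show "F \<in> G_group n" using orb_f[OF h] by (simp add: orbit_def)
qed

end
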